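(* Let $n,d\ge 1$, let $S$ be a fine mixed subdivision of $n\Delta_{d-1}$ and let $\sigma=\sigma(S)$ be its system of permutations. Then the numbered positions of the simplices in $S$ are completely determined by $\sigma$. More precisely, for each $i\in[n]$, the Minkowski decomposition of the $i$th simplex of $S$ is $$w_{a_1}+\cdots+w_{a_{i-1}}+w_1w_2\cdots w_d+w_{a_{i+1}}+\cdots+w_{a_n},$$ where, for each $j\ne i$, $a_j\in[d]$ is the unique source of the acyclic graph $G_{ij}(\sigma)$.
   Context: Notation: $[m]=\{1,\dots,m\}$. $\Delta_{d-1}$ is the convex hull of the standard basis vectors $w_1,\dots,w_d$ of $\mathbb R^d$, and $n\Delta_{d-1}$ is its dilation by $n$, with vertices $nw_1,\dots,nw_d$. A (nonempty) face of $\Delta_{d-1}$ is identified with its set of vertices, written as a word; in particular $w_aw_b$ is an edge and $w_1w_2\cdots w_d=\Delta_{d-1}$. Fine mixed subdivisions: a fine mixed cell is a Minkowski sum $B_1+\cdots+B_n$ of nonempty faces $B_i$ of $\Delta_{d-1}$ which lie in independent affine subspaces (i.e. $\dim(B_1+\cdots+B_n)=\sum_i\dim B_i$) and whose dimensions add up to $d-1$. A fine mixed subdivision $S$ of $n\Delta_{d-1}$ is a polyhedral subdivision of $n\Delta_{d-1}$ into fine mixed cells such that the intersection of any two cells is a face of both. Its cells (of all dimensions) are labeled by ordered Minkowski sums $S_1+\cdots+S_n$ of nonempty faces of $\Delta_{d-1}$ in such a way that if $B_1+\cdots+B_n$ is a face of $C_1+\cdots+C_n$ then $B_i$ is a face of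 $C_i$ for each $i$; such a labeling always exists and is fixed as part of the data of $S$. Simplices of $S$: for each $i\in[n]$ there is exactly one full-dimensional cell $S_1+\cdots+S_n$ of $S$ whose $i$th summand is $S_i=\Delta_{d-1}$; all its other summands are vertices, so it is a unit simplex, called the $i$th simplex of $S$. Its position is the vector $(x_1,\dots,x_d)$ with $x_a=|\{j\neq i: S_j=w_a\}|$, so that the simplex equals $(x_1,\dots,x_d)+\Delta_{d-1}$. System of permutations of $S$: for $a\ne b$ in $[d]$ and $r\in[n]$ there is a unique cell of $S$ having $r-1$ summands equal to $w_b$, $n-r$ summands equal to $w_a$ and one summand equal to $w_aw_b$; let $\sigma_{ab}(r)\in[n]$ be the index of the summand equal to $w_aw_b$. Then $\sigma_{ab}$ is a permutation of $[n]$ (written as the word $\sigma_{ab}(1)\cdots\sigma_{ab}(n)$), $\sigma_{ab}$ is the reverse of $\sigma_{ba}$, and $\sigma(S)=(\sigma_{ab})_{1\le a\ne b\le d}$. Graphs: for $i\ne j$ in $[n]$, $G_{ij}(\sigma)$ is the directed complete graph on $[d]$ in which the edge $ab$ is directed $a\to b$ if and only if $i$ appears before $j$ in the word $\sigma_{ab}$. For $\sigma=\sigma(S)$ all these graphs are acyclic, so each has a unique source (vertex with no incoming edge). *)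

theory Defs
  imports "HOL-Analysis.Analysis" "HOL-Library.Set_Algebras"
begin

text \<open>
  The index set $[d]$ is the finite type \<open>'d\<close>; the vertex $w_a$ is \<open>axis a 1\<close>. A nonempty face of
  the simplex is represented by its set of vertices, a nonempty set of type \<open>'d set\<close>.
  Summands are indexed by \<open>{1..n}\<close>; values of labels outside this range are irrelevant.
\<close>

definition face_hull :: "'d::finite set \<Rightarrow> (real^'d) set" where
  "face_hull A = convex hull ((\<lambda>a. axis a 1) ` A)"

definition dilated_simplex :: "nat \<Rightarrow> (real^'d::finite) set" where
  "dilated_simplex n = (\<lambda>x. real n *\<^sub>R x) ` face_hull UNIV"

definition minkowski :: "nat \<Rightarrow> (nat \<Rightarrow> 'd::finite set) \<Rightarrow> (real^'d) set" where
  "minkowski n B = (\<Sum>i\<in>{1..n}. face_hull (B i))"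

definition fine_mixed_cell :: "nat \<Rightarrow> (real^'d::finite) set \<Rightarrow> bool" where
  "fine_mixed_cell n P \<longleftrightarrow>
     (\<exists>B. (\<forall>i\<in>{1..n}. B i \<noteq> {}) \<and> P = minkowski n B \<and>
          aff_dim P = (\<Sum>i\<in>{1..n}. aff_dim (face_hull (B i))) \<and>
          (\<Sum>i\<in>{1..n}. aff_dim (face_hull (B i))) = int CARD('d) - 1)"

text \<open>A subdivision is given by its full-dimensional cells and a labeling of its cells of all
  dimensions.\<close>

record ('d::finite) labeled_subdivision =
  max_cells :: "(real^'d) set set"
  label :: "(real^'d) set \<Rightarrow> nat \<Rightarrow> 'd set"

definition cells :: "'d::finite labeled_subdivision \<Rightarrow> (real^'d) set set" where
  "cells S = {F. F \<noteq> {} \<and> (\<exists>P\<in>max_cells S. F face_of P)}"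

definition fine_mixed_subdivision :: "nat \<Rightarrow> 'd::finite labeled_subdivision \<Rightarrow> bool" where
  "fine_mixed_subdivision n S \<longleftrightarrow>
     finite (max_cells S) \<and>
     (\<forall>P\<in>max_cells S. fine_mixed_cell n P) \<and>
     \<Union> (max_cells S) = dilated_simplex n \<and>
     (\<forall>P\<in>max_cells S. \<forall>Q\<in>max_cells S. P \<inter> Q face_of P \<and> P \<inter> Q face_of Q) \<and>
     (\<forall>F\<in>cells S. (\<forall>i\<in>{1..n}. label S F i \<noteq> {}) \<and> F = minkowski n (label S F)) \<and>
     (\<forall>F\<in>cells S. \<forall>G\<in>cells S. F face_of G \<longrightarrow> (\<forall>i\<in>{1..n}. label S F i \<subseteq> label S G i))"

definition ith_simplex :: "'d::finite labeled_subdivision \<Rightarrow> nat \<Rightarrow> (real^'d) set" where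
  "ith_simplex S i = (THE P. P \<in> max_cells S \<and> label S P i = UNIV)"

definition position :: "nat \<Rightarrow> 'd::finite labeled_subdivision \<Rightarrow> nat \<Rightarrow> 'd \<Rightarrow> nat" where
  "position n S i a = card {j \<in> {1..n} - {i}. label S (ith_simplex S i) j = {a}}"

definition edge_cell ::
    "nat \<Rightarrow> 'd::finite labeled_subdivision \<Rightarrow> 'd \<Rightarrow> 'd \<Rightarrow> nat \<Rightarrow> (real^'d) set" where
  "edge_cell n S a b r = (THE F. F \<in> cells S \<and>
     card {k\<in>{1..n}. label S F k = {b}} = r - 1 \<and>
     card {k\<in>{1..n}. label S F k = {a}} = n - r \<and>
     card {k\<in>{1..n}. label S F k = {a, b}} = 1)"

text \<open>The system of permutations; only the values for distinct \<open>a\<close>, \<open>b\<close> and \<open>r \<in> {1..n}\<close> are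
  meaningful.\<close>

definition perm_system ::
    "nat \<Rightarrow> 'd::finite labeled_subdivision \<Rightarrow> 'd \<Rightarrow> 'd \<Rightarrow> nat \<Rightarrow> nat" where
  "perm_system n S a b r = (THE k. k \<in> {1..n} \<and> label S (edge_cell n S a b r) k = {a, b})"

definition appears_before :: "nat \<Rightarrow> (nat \<Rightarrow> nat) \<Rightarrow> nat \<Rightarrow> nat \<Rightarrow> bool" where
  "appears_before n w i j \<longleftrightarrow> (\<exists>r\<in>{1..n}. \<exists>s\<in>{1..n}. r < s \<and> w r = i \<and> w s = j)"

definition graph :: "nat \<Rightarrow> ('d \<Rightarrow> 'd \<Rightarrow> nat \<Rightarrow> nat) \<Rightarrow> nat \<Rightarrow> nat \<Rightarrow> ('d \<times> 'd) set" where
  "graph n \<sigma> i j = {(a, b). a \<noteq> b \<and> appears_before n (\<sigma> a b) i j}"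

definition is_source :: "('d \<times> 'd) set \<Rightarrow> 'd \<Rightarrow> bool" where
  "is_source G a \<longleftrightarrow> (\<forall>b. (b, a) \<notin> G)"

end

theory Submission imports Defs
begin

text \<open>
  Every point \<open>x\<close> of the dilated simplex lies in a maximal cell, and the label of that cell splits
  \<open>x\<close> into summands \<open>p\<^sub>1(x) + \<dots> + p\<^sub>n(x)\<close> with \<open>p\<^sub>k(x)\<close> in the \<open>k\<close>-th face. The faces of a fine cell
  span independent directions, so the splitting is unique inside a cell, and the monotonicity of
  labels makes it independent of the cell (\<open>summand_eq\<close>). The whole combinatorics of the subdivision
  can be read off from the functions \<open>p\<^sub>k\<close>. Two properties of them carry the proof.

  The first one is existence. For weights \<open>\<lambda>\<^sub>k \<ge> 0\<close>, not all zero, the map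
  \<open>\<phi>\<^sub>\<lambda>(x) = \<lambda>\<^sub>1 p\<^sub>1(x) + \<dots> + \<lambda>\<^sub>n p\<^sub>n(x)\<close> is continuous, goes from one dilated simplex to another and
  sends every face into the corresponding face. By Brouwer's theorem such a map is onto
  (\<open>face_preserving_surj\<close>, \<open>reweight_surj\<close>). Giving \<open>i\<close> the weight 1 and the others a tiny weight, and
  looking at a preimage of the barycenter of a face \<open>A\<close>, one finds a maximal cell whose \<open>i\<close>-th label
  contains \<open>A\<close> while all other labels meet \<open>A\<close> (\<open>cell_over_face\<close>). For \<open>A\<close> the set of all vertices
  this is the \<open>i\<close>-th simplex.

  The second one is rigidity: for \<open>K \<subseteq> {1..n}\<close> the sum of the \<open>p\<^sub>k(x)\<close> over \<open>k \<in> K\<close> determines every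
  \<open>p\<^sub>k(x)\<close> with \<open>k \<in> K\<close> (\<open>partial_sum_determines_summands\<close>). Inside one cell
  \<open>\<lambda>\<^sub>k |p\<^sub>k(x) - p\<^sub>k(y)| \<le> c |\<phi>\<^sub>\<lambda>(x) - \<phi>\<^sub>\<lambda>(y)|\<close> holds by linear algebra, with one constant \<open>c\<close> for all
  weights. If \<open>\<phi>\<^sub>\<lambda>\<close> is injective, then it is a bijection onto a convex set, and the estimate passes
  from cells to all pairs of points, because a Lipschitz bound on the closed pieces of a convex set
  is a Lipschitz bound on the whole set. The global estimate in turn keeps \<open>\<phi>\<^sub>\<mu>\<close> injective for all
  weights \<open>\<mu>\<close> within a fixed relative distance of \<open>\<lambda>\<close>. Starting from \<open>\<phi>\<^sub>1 = id\<close> one can therefore let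
  the weights outside \<open>K\<close> decrease geometrically to 0, and in the limit \<open>\<phi>\<^sub>\<lambda>\<close> is the sum over \<open>K\<close>.

  An edge \<open>a \<rightarrow> b\<close> of the graph of \<open>i\<close> and \<open>j\<close> means that on the way from \<open>n w\<^sub>a\<close> to \<open>n w\<^sub>b\<close> the summand
  \<open>i\<close> changes before \<open>j\<close>, so there is a point with \<open>p\<^sub>i = w\<^sub>b\<close> and \<open>p\<^sub>j = w\<^sub>a\<close> (\<open>graph_edge_point\<close>).
  A cell with \<open>a\<close> in label \<open>i\<close> and \<open>b\<close> in label \<open>j\<close> contains a point with \<open>p\<^sub>i = w\<^sub>a\<close> and \<open>p\<^sub>j = w\<^sub>b\<close>;
  the sums \<open>p\<^sub>i + p\<^sub>j\<close> agree, so rigidity excludes that both exist (\<open>no_edge_within_cell\<close>). Applied to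
  the cell over an arbitrary face \<open>A\<close>, this gives each set \<open>A\<close> of vertices an element without incoming
  edges from \<open>A\<close>, which is acyclicity. Applied to the \<open>i\<close>-th simplex, it says that the \<open>j\<close>-th label is
  the source.
\<close>

section \<open>Faces of the simplex and their Minkowski sums\<close>

definition scaled_simplex :: "real \<Rightarrow> (real^'d::finite) set" where
  "scaled_simplex r = {x. (\<forall>a. 0 \<le> x $ a) \<and> (\<Sum>a\<in>UNIV. x $ a) = r}"

lemma sum_axis: "(\<Sum>c\<in>UNIV. axis a (1::real) $ c) = 1" for a :: "'d::finite"
  by (simp add: axis_def if_distrib cong: if_cong)

lemma convex_face_coords:
  "convex {x :: real^'d::finite. (\<forall>a. 0 \<le> x $ a) \<and> (\<Sum>a\<in>UNIV. x $ a) = r \<and> (\<forall>a. a \<notin> A \<longrightarrow> x $ a = 0)}"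
proof -
  have "u * s + v * s = s" if "u + v = (1::real)" for u v s
    using that by (simp flip: distrib_right)
  then show ?thesis
    by (auto simp: convex_def sum.distrib simp flip: sum_distrib_left)
qed

lemma face_hull_coords:
  "face_hull A = {x :: real^'d::finite. (\<forall>a. 0 \<le> x $ a) \<and> (\<Sum>a\<in>UNIV. x $ a) = 1 \<and> (\<forall>a. a \<notin> A \<longrightarrow> x $ a = 0)}"
  (is "_ = ?R")
proof
  have "(\<lambda>a. axis a 1) ` A \<subseteq> ?R"
    by (auto simp: sum_axis) (auto simp: axis_def)
  then show "face_hull A \<subseteq> ?R"
    unfolding face_hull_def by (intro hull_minimal convex_face_coords)
next
  show "?R \<subseteq> face_hull A"
  proof
    fix x assume x: "x \<in> ?R"
    have 1: "(\<Sum>a\<in>A. x $ a) = 1"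
    proof -
      have "(\<Sum>a\<in>A. x $ a) = (\<Sum>a\<in>UNIV. x $ a)"
        by (rule sum.mono_neutral_left) (use x in auto)
      then show ?thesis using x by simp
    qed
    have 2: "(\<Sum>a\<in>A. x $ a *\<^sub>R axis a 1) = x"
    proof (rule vec_eq_iff[THEN iffD2], rule allI)
      fix c
      have "(\<Sum>a\<in>A. x $ a *\<^sub>R axis a 1) $ c = (\<Sum>a\<in>A. if a = c then x $ a else 0)"
        unfolding sum_component by (rule sum.cong) (auto simp: axis_def)
      also have "\<dots> = x $ c" using x by auto
      finally show "(\<Sum>a\<in>A. x $ a *\<^sub>R axis a 1) $ c = x $ c" .
    qed
    have "(\<Sum>a\<in>A. x $ a *\<^sub>R axis a 1) \<in> convex hull ((\<lambda>a. axis a (1::real)) ` A)"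
      by (rule convex_sum) (use x 1 in \<open>auto intro: hull_inc\<close>)
    then show "x \<in> face_hull A" by (simp only: 2 face_hull_def)
  qed
qed

lemma face_hull_mono: "A \<subseteq> B \<Longrightarrow> face_hull A \<subseteq> face_hull B"
  unfolding face_hull_def by (intro hull_mono image_mono)

lemma axis_in_face_hull: "a \<in> A \<Longrightarrow> axis a 1 \<in> face_hull A"
  unfolding face_hull_def by (auto intro: hull_inc)

lemma face_hull_singleton: "face_hull {a} = {axis a 1}"
  by (simp add: face_hull_def)

lemma face_hull_le_1: "x \<in> face_hull A \<Longrightarrow> x $ a \<le> 1"
proof -
  assume x: "x \<in> face_hull A"
  then have "x $ a \<le> (\<Sum>c\<in>UNIV. x $ c)"
    by (intro member_le_sum) (auto simp: face_hull_coords)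
  then show ?thesis using x by (simp add: face_hull_coords)
qed

lemma aff_dim_face_hull:
  fixes A :: "'d::finite set" shows "aff_dim (face_hull A) = int (card A) - 1"
proof -
  have "(\<lambda>a. axis a 1) ` A \<subseteq> (Basis :: (real^'d) set)"
    by (auto simp: Basis_vec_def)
  then have "independent ((\<lambda>a. axis a (1::real)) ` A)"
    using independent_Basis independent_mono by blast
  then have "\<not> affine_dependent ((\<lambda>a. axis a (1::real)) ` A)"
    using affine_dependent_imp_dependent by blast
  moreover have "card ((\<lambda>a. axis a (1::real)) ` A) = card A"
    by (rule card_image) (auto simp: inj_on_def axis_eq_axis)
  ultimately show ?thesis
    unfolding face_hull_def aff_dim_convex_hull using aff_dim_affine_independent by fastforce
qed

lemma dilated_simplex_coords:
  assumes "n \<ge> 1" shows "(dilated_simplex n :: (real^'d::finite) set) = scaled_simplex (real n)"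
proof
  show "dilated_simplex n \<subseteq> (scaled_simplex (real n) :: (real^'d) set)"
    by (auto simp: dilated_simplex_def face_hull_coords scaled_simplex_def simp flip: sum_distrib_left)
next
  show "scaled_simplex (real n) \<subseteq> (dilated_simplex n :: (real^'d) set)"
  proof
    fix x :: "real^'d" assume x: "x \<in> scaled_simplex (real n)"
    have "(1 / real n) *\<^sub>R x \<in> face_hull UNIV"
      using x assms by (auto simp: face_hull_coords scaled_simplex_def sum_divide_distrib[symmetric])
    then show "x \<in> dilated_simplex n"
      using assms by (auto simp: dilated_simplex_def intro!: image_eqI[where x = "(1 / real n) *\<^sub>R x"])
  qed
qed

lemma convex_scaled_simplex: "convex (scaled_simplex r)"
  using convex_face_coords[of r UNIV] by (simp add: scaled_simplex_def)

lemma compact_scaled_simplex: "compact (scaled_simplex r :: (real^'d::finite) set)"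
proof -
  have "scaled_simplex r = (\<Inter>a. {x :: real^'d. 0 \<le> x $ a}) \<inter> {x. (\<Sum>a\<in>UNIV. x $ a) = r}"
    by (auto simp: scaled_simplex_def)
  moreover have "closed \<dots>"
    by (intro closed_Int closed_INT closed_Collect_le closed_Collect_eq ballI continuous_intros)
  moreover have "bounded (scaled_simplex r :: (real^'d) set)"
    unfolding bounded_iff
  proof (intro exI ballI)
    fix x :: "real^'d" assume x: "x \<in> scaled_simplex r"
    have "norm x \<le> (\<Sum>a\<in>UNIV. \<bar>x $ a\<bar>)" by (rule norm_le_l1_cart)
    also have "\<dots> = r" using x by (simp add: scaled_simplex_def)
    finally show "norm x \<le> r" .
  qed
  ultimately show ?thesis by (simp add: compact_eq_bounded_closed)
qed

lemma minkowski_iff: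
  "x \<in> minkowski n B \<longleftrightarrow> (\<exists>q. (\<forall>k\<in>{1..n}. q k \<in> face_hull (B k)) \<and> x = (\<Sum>k\<in>{1..n}. q k))"
  by (auto simp: minkowski_def set_sum_alt)

lemma compact_minkowski: "compact (minkowski n B)"
proof -
  have "compact (\<Sum>i\<in>I. face_hull (B i))" if "finite I" for I :: "nat set"
    using that
  proof (induction I)
    case empty
    then show ?case by simp
  next
    case (insert k I)
    have "face_hull (B k) + (\<Sum>i\<in>I. face_hull (B i))
        = {x + y |x y. x \<in> face_hull (B k) \<and> y \<in> (\<Sum>i\<in>I. face_hull (B i))}"
      by (auto simp: set_plus_def)
    moreover have "compact (face_hull (B k))"
      unfolding face_hull_def by (intro finite_imp_compact_convex_hull) simp
    ultimately show ?case
      using insert compact_sums[of "face_hull (B k)" "\<Sum>i\<in>I. face_hull (B i)"] by simp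
  qed
  then show ?thesis by (simp add: minkowski_def)
qed

lemma convex_minkowski: "convex (minkowski n B)"
  unfolding minkowski_def face_hull_def by (intro convex_set_sum convex_convex_hull)

lemma minkowski_cong: "(\<And>k. k \<in> {1..n} \<Longrightarrow> B k = C k) \<Longrightarrow> minkowski n B = minkowski n C"
  by (simp add: minkowski_def)

section \<open>Two analytic tools\<close>

text \<open>
  To hit a given \<open>y\<close>, push \<open>x\<close> in the coordinates where \<open>f x\<close> is still too small: let
  \<open>m(x) = max(0, y - f x)\<close> coordinatewise and let \<open>h\<close> be \<open>x + m(x)\<close>, scaled back to the simplex. At a
  fixed point of \<open>h\<close> the vectors \<open>x\<close> and \<open>m(x)\<close> are proportional. If \<open>m(x) = 0\<close>, then \<open>y \<le> f x\<close>;
  otherwise \<open>x\<close> vanishes in the coordinates where \<open>f x\<close> exceeds \<open>y\<close>, and as \<open>f\<close> preserves faces there are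
  none, so \<open>f x \<le> y\<close>. Both times equality follows because the coordinate sums agree.
\<close>
lemma face_preserving_surj:
  fixes f :: "real^'d::finite \<Rightarrow> real^'d"
  assumes r: "r > 0"
    and cont: "continuous_on (scaled_simplex r) f"
    and im: "\<And>x. x \<in> scaled_simplex r \<Longrightarrow> f x \<in> scaled_simplex s"
    and face: "\<And>x a. x \<in> scaled_simplex r \<Longrightarrow> x $ a = 0 \<Longrightarrow> f x $ a = 0"
  shows "scaled_simplex s \<subseteq> f ` scaled_simplex r"
proof
  fix y :: "real^'d" assume y: "y \<in> scaled_simplex s"
  define m where "m x = (\<chi> a. max 0 (y $ a - f x $ a))" for x
  define M where "M x = (\<Sum>a\<in>UNIV. m x $ a)" for x
  define h where "h x = (r / (r + M x)) *\<^sub>R (x + m x)" for x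
  have m0: "0 \<le> m x $ a" for x a by (simp add: m_def)
  then have M0: "0 \<le> M x" for x by (simp add: M_def sum_nonneg)
  have contm: "continuous_on (scaled_simplex r) m"
    unfolding m_def by (intro continuous_intros cont)
  have contM: "continuous_on (scaled_simplex r) M"
    unfolding M_def by (intro continuous_intros contm)
  have rM: "r + M x \<noteq> 0" for x using r M0[of x] by linarith
  have "continuous_on (scaled_simplex r) h"
    unfolding h_def by (intro continuous_intros contm contM) (use rM in auto)
  moreover have "h \<in> scaled_simplex r \<rightarrow> scaled_simplex r"
  proof
    fix x :: "real^'d" assume x: "x \<in> scaled_simplex r"
    have "(\<Sum>a\<in>UNIV. h x $ a) = (r / (r + M x)) * (\<Sum>a\<in>UNIV. x $ a + m x $ a)"
      by (simp add: h_def sum_distrib_left)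
    also have "\<dots> = (r / (r + M x)) * (r + M x)"
      using x by (simp add: sum.distrib M_def scaled_simplex_def)
    also have "\<dots> = r" using rM by simp
    finally show "h x \<in> scaled_simplex r"
      using x r m0 M0[of x] by (auto simp: scaled_simplex_def h_def)
  qed
  moreover have "axis (undefined::'d) r \<in> scaled_simplex r"
    using r by (auto simp: scaled_simplex_def axis_def if_distrib cong: if_cong)
  then have "scaled_simplex r \<noteq> ({} :: (real^'d) set)" by blast
  ultimately obtain x where x: "x \<in> scaled_simplex r" and fixp: "h x = x"
    using brouwer[OF compact_scaled_simplex convex_scaled_simplex] by metis
  have eq: "x $ a * M x = r * m x $ a" for a
  proof -
    have "x $ a = r / (r + M x) * (x $ a + m x $ a)"
      using arg_cong[OF fixp, of "\<lambda>v. v $ a"] by (simp add: h_def)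
    then have "x $ a * (r + M x) = r * (x $ a + m x $ a)" using rM[of x] by (simp add: field_simps)
    then show ?thesis by (simp add: algebra_simps)
  qed
  have le: "f x $ a \<le> y $ a" if "M x \<noteq> 0" for a
  proof (rule ccontr)
    assume "\<not> f x $ a \<le> y $ a"
    then have "m x $ a = 0" by (simp add: m_def)
    then have "x $ a = 0" using eq[of a] that by simp
    then have "f x $ a = 0" by (rule face[OF x])
    with y \<open>\<not> f x $ a \<le> y $ a\<close> show False by (auto simp: scaled_simplex_def)
  qed
  have ge: "y $ a \<le> f x $ a" if "M x = 0" for a
  proof -
    have "m x $ a = 0" using that m0 unfolding M_def by (simp add: sum_nonneg_eq_0_iff)
    then show ?thesis by (auto simp: m_def max_def split: if_splits)
  qed
  have sums: "(\<Sum>a\<in>UNIV. f x $ a) = (\<Sum>a\<in>UNIV. y $ a)"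
    using im[OF x] y by (simp add: scaled_simplex_def)
  have "f x $ a = y $ a" for a
  proof (cases "M x = 0")
    case True
    then have "(\<Sum>a\<in>UNIV. f x $ a - y $ a) = 0" "\<And>a. 0 \<le> f x $ a - y $ a"
      using sums ge by (simp_all add: sum_subtractf)
    then show ?thesis by (simp add: sum_nonneg_eq_0_iff)
  next
    case False
    then have "(\<Sum>a\<in>UNIV. y $ a - f x $ a) = 0" "\<And>a. 0 \<le> y $ a - f x $ a"
      using sums le by (simp_all add: sum_subtractf)
    then show ?thesis by (simp add: sum_nonneg_eq_0_iff)
  qed
  then show "y \<in> f ` scaled_simplex r" using x by (metis vec_eq_iff image_eqI)
qed

text \<open>
  Along a segment inside \<open>D\<close> the bounds on the pieces add up; convexity is what makes the length of
  the segment the distance of its end points.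
\<close>
lemma lipschitz_on_convex_closed_cover:
  fixes f :: "'a::real_normed_vector \<Rightarrow> 'b::metric_space"
  assumes D: "convex D" and "finite Q" and cl: "\<And>q. q \<in> Q \<Longrightarrow> closed q"
    and cover: "D \<subseteq> \<Union> Q" and lip: "\<And>q. q \<in> Q \<Longrightarrow> c-lipschitz_on q f"
    and c: "c \<ge> 0"
  shows "c-lipschitz_on D f"
proof (rule lipschitz_onI)
  fix x y assume xy: "x \<in> D" "y \<in> D"
  define g where "g t = (1 - t) *\<^sub>R x + t *\<^sub>R y" for t :: real
  have gl: "dist (g s) (g t) = dist s t * dist x y" for s t
  proof -
    have "g s - g t = (t - s) *\<^sub>R (x - y)" by (simp add: g_def algebra_simps)
    then show ?thesis by (simp add: dist_norm abs_minus_commute)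
  qed
  have contg: "continuous_on UNIV g" unfolding g_def by (intro continuous_intros)
  have "(c * dist x y)-lipschitz_on {0..1} (f \<circ> g)"
  proof (rule lipschitz_on_closed_Union[where I = Q and U = "\<lambda>q. g -` q"])
    fix q assume q: "q \<in> Q"
    show "closed (g -` q)" using cl[OF q] contg by (simp add: closed_vimage)
    show "(c * dist x y)-lipschitz_on (g -` q) (f \<circ> g)"
    proof (rule lipschitz_onI)
      fix s t assume "s \<in> g -` q" "t \<in> g -` q"
      then have "dist (f (g s)) (f (g t)) \<le> c * dist (g s) (g t)"
        using lipschitz_onD[OF lip[OF q]] by simp
      then show "dist ((f \<circ> g) s) ((f \<circ> g) t) \<le> c * dist x y * dist s t"
        by (simp add: gl mult_ac)
    qed (use c in auto)
  next
    show "{0..1} \<subseteq> (\<Union>q\<in>Q. g -` q)"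
    proof
      fix t :: real assume "t \<in> {0..1}"
      then have "g t \<in> D" using D xy unfolding g_def convex_alt by auto
      then show "t \<in> (\<Union>q\<in>Q. g -` q)" using cover by auto
    qed
  qed (use c \<open>finite Q\<close> in auto)
  then have "dist ((f \<circ> g) 0) ((f \<circ> g) 1) \<le> c * dist x y * dist 0 (1::real)"
    by (rule lipschitz_onD) auto
  then show "dist (f x) (f y) \<le> c * dist x y" by (simp add: g_def)
qed (rule c)

section \<open>Independence of the summands of a cell\<close>

text \<open>
  The number of faces \<open>B k\<close> through the vertex \<open>a\<close> is the maximum of the \<open>a\<close>-th coordinate on the
  Minkowski sum, so it depends on the sum only and is monotone in it.
\<close>
lemma card_containing_le:
  fixes B C :: "nat \<Rightarrow> 'd::finite set"
  assumes ne: "\<forall>k\<in>{1..n}. B k \<noteq> {}" and sub: "minkowski n B \<subseteq> minkowski n C"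
  shows "card {k\<in>{1..n}. a \<in> B k} \<le> card {k\<in>{1..n}. a \<in> C k}"
proof -
  define q where "q k = axis (if a \<in> B k then a else SOME b. b \<in> B k) (1::real)" for k
  have q: "q k \<in> face_hull (B k)" if "k \<in> {1..n}" for k
    unfolding q_def by (rule axis_in_face_hull) (use ne that in \<open>auto simp: some_in_eq\<close>)
  then have "(\<Sum>k\<in>{1..n}. q k) \<in> minkowski n C" using sub minkowski_iff by blast
  then obtain p where p: "\<And>k. k \<in> {1..n} \<Longrightarrow> p k \<in> face_hull (C k)"
    and eq: "(\<Sum>k\<in>{1..n}. q k) = (\<Sum>k\<in>{1..n}. p k)" unfolding minkowski_iff by blast
  have "real (card {k\<in>{1..n}. a \<in> B k}) = (\<Sum>k\<in>{1..n}. if a \<in> B k then 1 else 0)"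
    by (simp flip: sum.inter_filter)
  also have "\<dots> \<le> (\<Sum>k\<in>{1..n}. q k $ a)"
    by (rule sum_mono) (auto simp: q_def axis_def)
  also have "\<dots> = (\<Sum>k\<in>{1..n}. p k $ a)" using eq by (metis sum_component)
  also have "\<dots> \<le> (\<Sum>k\<in>{1..n}. if a \<in> C k then 1 else 0)"
  proof (rule sum_mono)
    fix k assume "k \<in> {1..n}"
    then show "p k $ a \<le> (if a \<in> C k then 1 else 0)"
      using p[of k] face_hull_le_1[of "p k"] by (auto simp: face_hull_coords)
  qed
  also have "\<dots> = real (card {k\<in>{1..n}. a \<in> C k})"
    by (simp flip: sum.inter_filter)
  finally show ?thesis by simp
qed

text \<open>
  This transfers fineness from one decomposition of a cell to another: the labeling of a
  subdivision need not be the decomposition that witnesses that a maximal cell is fine.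
\<close>
lemma sum_card_le_of_minkowski_subset:
  fixes B C :: "nat \<Rightarrow> 'd::finite set"
  assumes "\<forall>k\<in>{1..n}. B k \<noteq> {}" and "minkowski n B \<subseteq> minkowski n C"
  shows "(\<Sum>k\<in>{1..n}. card (B k)) \<le> (\<Sum>k\<in>{1..n}. card (C k))"
proof -
  have *: "(\<Sum>k\<in>{1..n}. card (B k)) = (\<Sum>a\<in>UNIV. card {k\<in>{1..n}. a \<in> B k})" for B :: "nat \<Rightarrow> 'd set"
  proof -
    have "(\<Sum>k\<in>{1..n}. card (B k)) = (\<Sum>k\<in>{1..n}. \<Sum>a\<in>UNIV. if a \<in> B k then 1 else 0)"
      by (intro sum.cong) (simp_all flip: sum.inter_filter)
    also have "\<dots> = (\<Sum>a\<in>UNIV. \<Sum>k\<in>{1..n}. if a \<in> B k then 1 else 0)" by (rule sum.swap)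
    also have "\<dots> = (\<Sum>a\<in>UNIV. card {k\<in>{1..n}. a \<in> B k})"
      by (intro sum.cong) (simp_all flip: sum.inter_filter)
    finally show ?thesis .
  qed
  show ?thesis unfolding * by (intro sum_mono card_containing_le assms)
qed

text \<open>
  The linear space parallel to the affine hull of a nonempty face.
\<close>
definition face_directions :: "'d::finite set \<Rightarrow> (real^'d) set" where
  "face_directions A = {v. (\<forall>a. a \<notin> A \<longrightarrow> v $ a = 0) \<and> (\<Sum>a\<in>UNIV. v $ a) = 0}"

lemma face_hull_diff:
  "x \<in> face_hull A \<Longrightarrow> y \<in> face_hull A \<Longrightarrow> x - y \<in> face_directions A"
  by (auto simp: face_hull_coords face_directions_def sum_subtractf)

lemma scale_face_directions: "v \<in> face_directions A \<Longrightarrow> r *\<^sub>R v \<in> face_directions A"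
  by (auto simp: face_directions_def simp flip: sum_distrib_left)

lemma face_directions_expand:
  assumes v: "v \<in> face_directions A" and r: "r \<in> A"
  shows "v = (\<Sum>a\<in>A - {r}. v $ a *\<^sub>R (axis a 1 - axis r 1))"
proof (rule vec_eq_iff[THEN iffD2], rule allI)
  fix b
  have "(\<Sum>a\<in>A. v $ a) = (\<Sum>a\<in>UNIV. v $ a)"
    by (rule sum.mono_neutral_left) (use v in \<open>auto simp: face_directions_def\<close>)
  then have s: "(\<Sum>a\<in>A - {r}. v $ a) = - (v $ r)"
    using v r by (simp add: face_directions_def sum_diff1)
  have "(\<Sum>a\<in>A - {r}. v $ a *\<^sub>R (axis a 1 - axis r 1)) $ b
      = (\<Sum>a\<in>A - {r}. (if a = b then v $ a else 0) - (if b = r then v $ a else 0))"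
    unfolding sum_component by (rule sum.cong) (auto simp: axis_def)
  also have "\<dots> = (\<Sum>a\<in>A - {r}. if a = b then v $ a else 0) - (if b = r then \<Sum>a\<in>A - {r}. v $ a else 0)"
    by (simp add: sum_subtractf)
  also have "\<dots> = v $ b" using s v by (auto simp: face_directions_def)
  finally show "v $ b = (\<Sum>a\<in>A - {r}. v $ a *\<^sub>R (axis a 1 - axis r 1)) $ b" by simp
qed

text \<open>
  Choose a root \<open>\<rho> k\<close> in every face. The edge vectors from the roots span the directions of the
  Minkowski sum and there are at most as many of them as its dimension, so they form a basis indexed
  without repetition. The projections are the linear maps that keep the basis vectors of the \<open>k\<close>-th
  face and kill the others.
\<close>
lemma independent_faces_projection:
  fixes L :: "nat \<Rightarrow> 'd::finite set"
  assumes ne: "\<forall>k\<in>{1..n}. L k \<noteq> {}"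
    and card: "(\<Sum>k\<in>{1..n}. card (L k)) + 1 \<le> n + CARD('d)"
    and dim: "aff_dim (minkowski n L) = int CARD('d) - 1"
  shows "\<exists>F. \<forall>k\<in>{1..n}. linear (F k) \<and>
     (\<forall>v. (\<forall>j\<in>{1..n}. v j \<in> face_directions (L j)) \<longrightarrow> F k (\<Sum>j\<in>{1..n}. v j) = v k)"
proof -
  define \<rho> where "\<rho> k = (SOME a. a \<in> L k)" for k
  have \<rho>: "\<rho> k \<in> L k" if "k \<in> {1..n}" for k using ne that by (auto simp: \<rho>_def some_in_eq)
  define I where "I = Sigma {1..n} (\<lambda>k. L k - {\<rho> k})"
  define e where "e = (\<lambda>(k, a). axis a 1 - axis (\<rho> k) 1 :: real^'d)"
  have finI: "finite I" by (auto simp: I_def)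
  have "card I + n = (\<Sum>k\<in>{1..n}. card (L k - {\<rho> k}) + 1)"
    unfolding I_def by (subst card_SigmaI) (auto simp only: finite sum.distrib, auto)
  also have "\<dots> = (\<Sum>k\<in>{1..n}. card (L k))"
    by (rule sum.cong) (use \<rho> in \<open>simp_all add: card_Suc_Diff1 del: card_Diff_insert\<close>)
  finally have cardI: "card I + 1 \<le> CARD('d)" using card by linarith
  have expand: "v k = (\<Sum>a\<in>L k - {\<rho> k}. v k $ a *\<^sub>R e (k, a))"
    if "v k \<in> face_directions (L k)" "k \<in> {1..n}" for v k
    using face_directions_expand[OF that(1) \<rho>[OF that(2)]] by (simp add: e_def)
  have span: "(\<Sum>k\<in>{1..n}. v k) \<in> span (e ` I)"
    if v: "\<forall>j\<in>{1..n}. v j \<in> face_directions (L j)" for v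
  proof (rule span_sum)
    fix k assume k: "k \<in> {1..n}"
    have "(\<Sum>a\<in>L k - {\<rho> k}. v k $ a *\<^sub>R e (k, a)) \<in> span (e ` I)"
      by (intro span_sum span_scale span_base) (use k in \<open>auto simp: I_def\<close>)
    then show "v k \<in> span (e ` I)" using expand[of v k] v k by simp
  qed
  have "minkowski n L \<noteq> {}" using dim by auto
  then obtain x0 where x0: "x0 \<in> minkowski n L" by blast
  let ?P = "(\<lambda>x. - x0 + x) ` minkowski n L"
  have Psub: "?P \<subseteq> span (e ` I)"
  proof
    fix z assume "z \<in> ?P"
    then obtain x where x: "x \<in> minkowski n L" "z = x - x0" by auto
    obtain q p where "\<forall>k\<in>{1..n}. q k \<in> face_hull (L k)" "x = (\<Sum>k\<in>{1..n}. q k)"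
      "\<forall>k\<in>{1..n}. p k \<in> face_hull (L k)" "x0 = (\<Sum>k\<in>{1..n}. p k)"
      using x x0 by (auto simp: minkowski_iff)
    then have "z = (\<Sum>k\<in>{1..n}. q k - p k)" "\<forall>k\<in>{1..n}. q k - p k \<in> face_directions (L k)"
      using x by (auto simp: sum_subtractf face_hull_diff)
    then show "z \<in> span (e ` I)" using span[of "\<lambda>k. q k - p k"] by simp
  qed
  have "int CARD('d) - 1 = aff_dim ?P" by (simp only: aff_dim_translation_eq dim)
  also have "\<dots> = int (dim ?P)" 
    by (rule aff_dim_zero) (rule hull_inc, use x0 in \<open>auto intro!: image_eqI[of _ _ x0]\<close>)
  finally have d: "CARD('d) = dim ?P + 1" by linarith
  have "dim ?P \<le> dim (span (e ` I))" by (rule dim_subset[OF Psub])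
  then have dI: "card I \<le> dim (span (e ` I))" using d cardI by linarith
  have "dim (span (e ` I)) \<le> card (e ` I)"
    by (rule dim_le_card) (use finI in auto)
  then have "card (e ` I) = card I" using dI card_image_le[OF finI, of e] by linarith
  then have inj: "inj_on e I" by (rule eq_card_imp_inj_on[OF finI])
  have indep: "independent (e ` I)"
    by (rule card_le_dim_spanning[where V = "span (e ` I)"])
      (use dI finI \<open>card (e ` I) = card I\<close> in \<open>auto intro: span_base\<close>)
  have "\<exists>F. linear F \<and> (\<forall>s\<in>I. F (e s) = (if fst s = k then e s else 0))" for k
  proof -
    obtain F where "linear F" "\<forall>x\<in>e ` I. F x = (if fst (the_inv_into I e x) = k then x else 0)"
      using linear_independent_extend[OF indep,
          of "\<lambda>x. if fst (the_inv_into I e x) = k then x else 0"] by blast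
    then show ?thesis using inj by (auto simp: the_inv_into_f_f)
  qed
  then obtain F where F: "\<And>k. linear (F k)" "\<And>k s. s \<in> I \<Longrightarrow> F k (e s) = (if fst s = k then e s else 0)"
    by metis
  have "F k (\<Sum>j\<in>{1..n}. v j) = v k"
    if k: "k \<in> {1..n}" and v: "\<forall>j\<in>{1..n}. v j \<in> face_directions (L j)" for k v
  proof -
    have *: "F k (v j) = (if j = k then v k else 0)" if j: "j \<in> {1..n}" for j
    proof -
      have "F k (v j) = F k (\<Sum>a\<in>L j - {\<rho> j}. v j $ a *\<^sub>R e (j, a))"
        using expand[of v j] v j by simp
      also have "\<dots> = (\<Sum>a\<in>L j - {\<rho> j}. v j $ a *\<^sub>R F k (e (j, a)))"
        using F(1) by (simp add: linear_sum linear_cmul)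
      also have "\<dots> = (\<Sum>a\<in>L j - {\<rho> j}. if j = k then v j $ a *\<^sub>R e (j, a) else 0)"
        by (rule sum.cong) (use j F(2) in \<open>auto simp: I_def\<close>)
      also have "\<dots> = (if j = k then v k else 0)"
        using expand[of v k] v k by auto
      finally show ?thesis .
    qed
    have "F k (\<Sum>j\<in>{1..n}. v j) = (\<Sum>j\<in>{1..n}. F k (v j))"
      using F(1) by (simp add: linear_sum)
    also have "\<dots> = (\<Sum>j\<in>{1..n}. if j = k then v k else 0)" by (rule sum.cong) (auto simp: *)
    also have "\<dots> = v k" using k by simp
    finally show ?thesis .
  qed
  then show ?thesis using F(1) by blast
qed

section \<open>Labels of edge cells\<close>

text \<open>
  The three counts add up to \<open>n\<close>, so all labels are accounted for. All summands but the one on the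
  edge are vertices, which shows that the cell is a fixed unit segment, whatever its labels are.
\<close>
lemma edge_labels_sum:
  fixes L :: "nat \<Rightarrow> 'd::finite set"
  assumes ab: "a \<noteq> b" and r: "r \<in> {1..n}"
    and cb: "card {k\<in>{1..n}. L k = {b}} = r - 1"
    and ca: "card {k\<in>{1..n}. L k = {a}} = n - r"
    and cab: "card {k\<in>{1..n}. L k = {a, b}} = 1"
  shows "\<exists>j\<in>{1..n}. (\<forall>k\<in>{1..n}. L k = {a, b} \<longleftrightarrow> k = j) \<and>
    (\<forall>k\<in>{1..n}. k \<noteq> j \<longrightarrow> L k = {a} \<or> L k = {b}) \<and>
    (\<forall>q. (\<forall>k\<in>{1..n}. q k \<in> face_hull (L k)) \<longrightarrow>
       (\<Sum>k\<in>{1..n}. q k) = (real n - real r) *\<^sub>R axis a 1 + (real r - 1) *\<^sub>R axis b 1 + q j)"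
proof -
  let ?A = "{k\<in>{1..n}. L k = {a}}" and ?B = "{k\<in>{1..n}. L k = {b}}"
  obtain j where j: "{k\<in>{1..n}. L k = {a, b}} = {j}" using cab card_1_singletonE by blast
  then have "L j = {a, b}" by blast
  then have disj: "?A \<inter> ?B = {}" "(?A \<union> ?B) \<inter> {j} = {}" using ab by auto
  have "card (?A \<union> ?B \<union> {j}) = card (?A \<union> ?B) + card {j}"
    by (rule card_Un_disjoint) (use disj in auto)
  also have "card (?A \<union> ?B) = card ?A + card ?B"
    by (rule card_Un_disjoint) (use disj in auto)
  finally have c: "card (?A \<union> ?B \<union> {j}) = card {1..n}" using ca cb r by simp
  have "?A \<union> ?B \<union> {j} \<subseteq> {1..n}" using j by auto
  from card_subset_eq[OF finite_atLeastAtMost this c]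
  have part: "{1..n} = ?A \<union> ?B \<union> {j}" ..
  show ?thesis
  proof (intro bexI[of _ j] conjI ballI allI impI)
    show "j \<in> {1..n}" using j by blast
    show "L k = {a, b} \<longleftrightarrow> k = j" if "k \<in> {1..n}" for k using j that by blast
    show "L k = {a} \<or> L k = {b}" if "k \<in> {1..n}" "k \<noteq> j" for k using part that by auto
    fix q :: "nat \<Rightarrow> real^'d" assume q: "\<forall>k\<in>{1..n}. q k \<in> face_hull (L k)"
    have vertex: "q k = axis c 1" if "k \<in> {1..n}" "L k = {c}" for k c
      using q[rule_format, OF that(1)] that(2) by (simp add: face_hull_singleton)
    have "(\<Sum>k\<in>{1..n}. q k) = (\<Sum>k\<in>?A \<union> ?B \<union> {j}. q k)"
      by (rule arg_cong[OF part])
    also have "\<dots> = (\<Sum>k\<in>?A \<union> ?B. q k) + (\<Sum>k\<in>{j}. q k)"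
      by (rule sum.union_disjoint) (use disj in auto)
    also have "(\<Sum>k\<in>?A \<union> ?B. q k) = (\<Sum>k\<in>?A. q k) + (\<Sum>k\<in>?B. q k)"
      by (rule sum.union_disjoint) (use disj in auto)
    also have "(\<Sum>k\<in>?A. q k) = (\<Sum>k\<in>?A. axis a 1)"
      by (rule sum.cong) (use vertex in auto)
    also have "(\<Sum>k\<in>?B. q k) = (\<Sum>k\<in>?B. axis b 1)"
      by (rule sum.cong) (use vertex in auto)
    finally show "(\<Sum>k\<in>{1..n}. q k) = (real n - real r) *\<^sub>R axis a 1 + (real r - 1) *\<^sub>R axis b 1 + q j"
      using ca cb r by (simp add: sum_constant_scaleR of_nat_diff del: sum_constant)
  qed
qed

text \<open>
  Exchanging \<open>a\<close> and \<open>b\<close> and replacing \<open>r\<close> by \<open>n + 1 - r\<close> describes the same cell.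
\<close>
lemma perm_system_reverse:
  assumes "r \<in> {1..n}"
  shows "perm_system n S b a (n + 1 - r) = perm_system n S a b r"
proof -
  have "n + 1 - r - 1 = n - r" "n - (n + 1 - r) = r - 1" using assms by auto
  then have "edge_cell n S b a (n + 1 - r) = edge_cell n S a b r"
    unfolding edge_cell_def insert_commute[of b a] by (metis (lifting))
  then show ?thesis unfolding perm_system_def insert_commute[of b a] by simp
qed

text \<open>
  The lattice points of the edge from \<open>n w\<^sub>a\<close> to \<open>n w\<^sub>b\<close>; the edge cell with parameter \<open>r\<close> is the segment
  between the points with index \<open>r - 1\<close> and \<open>r\<close>.
\<close>
definition edge_point :: "nat \<Rightarrow> 'd::finite \<Rightarrow> 'd \<Rightarrow> nat \<Rightarrow> real^'d" where
  "edge_point n a b t = (real n - real t) *\<^sub>R axis a 1 + real t *\<^sub>R axis b 1"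

lemma edge_point_in_simplex: "t \<le> n \<Longrightarrow> edge_point n a b t \<in> scaled_simplex (real n)"
  by (auto simp: scaled_simplex_def edge_point_def sum.distrib sum_axis axis_def
      simp flip: sum_distrib_left)

section \<open>Summand functions and reweighted sums\<close>

text \<open>
  The choice is among the decompositions of \<open>x\<close> along the labels of maximal cells. In a fine mixed
  subdivision they all have the same terms with index in \<open>{1..n}\<close>, by \<open>summand_eq\<close> below.
\<close>
definition summand :: "nat \<Rightarrow> 'd::finite labeled_subdivision \<Rightarrow> real^'d \<Rightarrow> nat \<Rightarrow> real^'d" where
  "summand n S x = (SOME q. \<exists>P\<in>max_cells S.
     (\<forall>k\<in>{1..n}. q k \<in> face_hull (label S P k)) \<and> x = (\<Sum>k\<in>{1..n}. q k))"

text \<open>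
  Each cell is mapped onto the Minkowski sum with its \<open>k\<close>-th summand scaled by \<open>lam k\<close>.
\<close>
definition reweight :: "nat \<Rightarrow> 'd::finite labeled_subdivision \<Rightarrow> (nat \<Rightarrow> real) \<Rightarrow> real^'d \<Rightarrow> real^'d" where
  "reweight n S lam x = (\<Sum>k\<in>{1..n}. lam k *\<^sub>R summand n S x k)"

context
  fixes n :: nat and S :: "'d::finite labeled_subdivision"
  assumes n_pos: "n \<ge> 1" and subdivision: "fine_mixed_subdivision n S"
begin

lemma Union_max_cells: "\<Union> (max_cells S) = scaled_simplex (real n)"
  using subdivision n_pos by (simp add: fine_mixed_subdivision_def dilated_simplex_coords)

lemma max_cell_nonempty_compact_convex:
  assumes "P \<in> max_cells S" shows "P \<noteq> {}" "compact P" "convex P"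
proof -
  obtain B where "P = minkowski n B" "aff_dim P = int CARD('d) - 1"
    using assms subdivision unfolding fine_mixed_subdivision_def fine_mixed_cell_def by force
  moreover have "int CARD('d) \<noteq> 0" by simp
  ultimately show "P \<noteq> {}" "compact P" "convex P"
    using compact_minkowski convex_minkowski by (auto simp del: of_nat_eq_0_iff)
qed

lemma max_cell_in_cells: "P \<in> max_cells S \<Longrightarrow> P \<in> cells S"
  unfolding cells_def using max_cell_nonempty_compact_convex face_of_refl by blast

lemma label_nonempty: "F \<in> cells S \<Longrightarrow> k \<in> {1..n} \<Longrightarrow> label S F k \<noteq> {}"
  and cell_eq_minkowski: "F \<in> cells S \<Longrightarrow> F = minkowski n (label S F)"
  and label_mono: "F \<in> cells S \<Longrightarrow> G \<in> cells S \<Longrightarrow> F face_of G \<Longrightarrow> k \<in> {1..n} \<Longrightarrow>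
     label S F k \<subseteq> label S G k"
  using subdivision by (simp_all add: fine_mixed_subdivision_def)

lemma cell_iff:
  assumes "F \<in> cells S"
  shows "x \<in> F \<longleftrightarrow> (\<exists>q. (\<forall>k\<in>{1..n}. q k \<in> face_hull (label S F k)) \<and> x = (\<Sum>k\<in>{1..n}. q k))"
  using minkowski_iff[of x n "label S F"] cell_eq_minkowski[OF assms] by simp

text \<open>
  The labels of a maximal cell form a fine decomposition: a witness \<open>B\<close> of fineness and the label have
  the same Minkowski sum, hence the same total number of vertices.
\<close>
lemma max_cell_label_fine:
  assumes P: "P \<in> max_cells S"
  shows "aff_dim (minkowski n (label S P)) = int CARD('d) - 1"
    and "(\<Sum>k\<in>{1..n}. card (label S P k)) + 1 \<le> n + CARD('d)"
proof -
  let ?L = "label S P"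
  obtain B where B: "\<forall>k\<in>{1..n}. B k \<noteq> {}" "P = minkowski n B" "aff_dim P = int CARD('d) - 1"
    "(\<Sum>k\<in>{1..n}. aff_dim (face_hull (B k))) = int CARD('d) - 1"
    using P subdivision unfolding fine_mixed_subdivision_def fine_mixed_cell_def by force
  have PL: "P = minkowski n ?L" using P cell_eq_minkowski max_cell_in_cells by blast
  show "aff_dim (minkowski n ?L) = int CARD('d) - 1" using B PL by simp
  have "(\<Sum>k\<in>{1..n}. card (?L k)) \<le> (\<Sum>k\<in>{1..n}. card (B k))"
    by (rule sum_card_le_of_minkowski_subset)
      (use PL B P label_nonempty max_cell_in_cells in auto)
  moreover have "int (\<Sum>k\<in>{1..n}. card (B k)) - int n = int CARD('d) - 1"
    using B(4) by (simp add: aff_dim_face_hull sum_subtractf)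
  ultimately show "(\<Sum>k\<in>{1..n}. card (?L k)) + 1 \<le> n + CARD('d)" by linarith
qed

lemma max_cell_projection:
  assumes P: "P \<in> max_cells S"
  shows "\<exists>F. \<forall>k\<in>{1..n}. linear (F k) \<and>
     (\<forall>v. (\<forall>j\<in>{1..n}. v j \<in> face_directions (label S P j)) \<longrightarrow> F k (\<Sum>j\<in>{1..n}. v j) = v k)"
  by (rule independent_faces_projection)
    (use max_cell_label_fine[OF P] P label_nonempty max_cell_in_cells in auto)

lemma max_cell_decomposition_unique:
  assumes P: "P \<in> max_cells S"
    and q: "\<forall>k\<in>{1..n}. q k \<in> face_hull (label S P k)"
    and p: "\<forall>k\<in>{1..n}. p k \<in> face_hull (label S P k)"
    and eq: "(\<Sum>k\<in>{1..n}. q k) = (\<Sum>k\<in>{1..n}. p k)" and k: "k \<in> {1..n}"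
  shows "q k = p k"
proof -
  obtain F where F: "linear (F k)"
    "\<And>v. (\<forall>j\<in>{1..n}. v j \<in> face_directions (label S P j)) \<Longrightarrow> F k (\<Sum>j\<in>{1..n}. v j) = v k"
    using max_cell_projection[OF P] k by blast
  have "F k (\<Sum>j\<in>{1..n}. q j - p j) = q k - p k"
    by (rule F(2)[of "\<lambda>j. q j - p j"]) (use q p face_hull_diff in blast)
  moreover have "(\<Sum>j\<in>{1..n}. q j - p j) = 0" using eq by (simp add: sum_subtractf)
  ultimately show ?thesis using linear_0[OF F(1)] by simp
qed

text \<open>
  If \<open>x\<close> lies in the maximal cells \<open>P\<close> and \<open>Q\<close>, a decomposition along the label of the common face
  \<open>P \<inter> Q\<close> is, by monotonicity of labels, a decomposition along the labels of \<open>P\<close> and of \<open>Q\<close>; both are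
  unique.
\<close>
lemma summand_eq:
  assumes F: "F \<in> cells S" and q: "\<forall>k\<in>{1..n}. q k \<in> face_hull (label S F k)"
    and x: "x = (\<Sum>k\<in>{1..n}. q k)" and k: "k \<in> {1..n}"
  shows "summand n S x k = q k"
proof -
  obtain P where P: "P \<in> max_cells S" "F face_of P" using F by (auto simp: cells_def)
  note PC = max_cell_in_cells[OF P(1)]
  have qP: "\<forall>k\<in>{1..n}. q k \<in> face_hull (label S P k)"
    using q label_mono[OF F PC P(2)] face_hull_mono by blast
  have "\<exists>p. \<exists>Q\<in>max_cells S. (\<forall>k\<in>{1..n}. p k \<in> face_hull (label S Q k)) \<and>
      x = (\<Sum>k\<in>{1..n}. p k)"
    using P(1) qP x by blast
  from someI_ex[OF this]
  obtain Q where Q: "Q \<in> max_cells S"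
    and pQ: "\<forall>k\<in>{1..n}. summand n S x k \<in> face_hull (label S Q k)"
    and xp: "x = (\<Sum>k\<in>{1..n}. summand n S x k)"
    unfolding summand_def by blast
  note QC = max_cell_in_cells[OF Q]
  define G where "G = P \<inter> Q"
  have xG: "x \<in> G"
    using cell_iff[OF PC] cell_iff[OF QC] qP x pQ xp unfolding G_def by blast
  have G: "G face_of P" "G face_of Q"
    using subdivision P(1) Q by (simp_all add: fine_mixed_subdivision_def G_def)
  have GC: "G \<in> cells S" using G(1) P(1) xG by (auto simp: cells_def)
  obtain g where g: "\<forall>k\<in>{1..n}. g k \<in> face_hull (label S G k)" "x = (\<Sum>k\<in>{1..n}. g k)"
    using xG cell_iff[OF GC] by blast
  have "g k = q k"
    by (rule max_cell_decomposition_unique[OF P(1) _ qP _ k])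
      (use g x label_mono[OF GC PC G(1)] face_hull_mono in blast)+
  moreover have "g k = summand n S x k"
    by (rule max_cell_decomposition_unique[OF Q _ pQ _ k])
      (use g xp label_mono[OF GC QC G(2)] face_hull_mono in \<open>blast, metis\<close>)
  ultimately show ?thesis by simp
qed

lemma summand_in_label:
  assumes F: "F \<in> cells S" and x: "x \<in> F" and k: "k \<in> {1..n}"
  shows "summand n S x k \<in> face_hull (label S F k)"
  using x summand_eq[OF F] k unfolding cell_iff[OF F] by fastforce

lemma simplex_in_max_cell:
  assumes "x \<in> scaled_simplex (real n)" obtains P where "P \<in> max_cells S" "x \<in> P"
  using assms Union_max_cells by blast

lemma sum_summand:
  assumes "x \<in> scaled_simplex (real n)" shows "(\<Sum>k\<in>{1..n}. summand n S x k) = x"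
proof -
  obtain P where P: "P \<in> max_cells S" "x \<in> P" using simplex_in_max_cell assms by blast
  note PC = max_cell_in_cells[OF P(1)]
  obtain q where q: "\<forall>k\<in>{1..n}. q k \<in> face_hull (label S P k)" "x = (\<Sum>k\<in>{1..n}. q k)"
    using P(2) cell_iff[OF PC] by blast
  have "(\<Sum>k\<in>{1..n}. summand n S x k) = (\<Sum>k\<in>{1..n}. q k)"
    by (rule sum.cong) (use summand_eq[OF PC q] in auto)
  then show ?thesis using q(2) by simp
qed

lemma summand_in_simplex:
  assumes "x \<in> scaled_simplex (real n)" and "k \<in> {1..n}"
  shows "summand n S x k \<in> face_hull UNIV"
proof -
  obtain P where "P \<in> max_cells S" "x \<in> P" using simplex_in_max_cell assms by blast
  then show ?thesis
    using summand_in_label max_cell_in_cells face_hull_mono[OF subset_UNIV] assms(2) by blast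
qed

lemma summand_support:
  assumes x: "x \<in> scaled_simplex (real n)" and a: "x $ a = 0" and k: "k \<in> {1..n}"
  shows "summand n S x k $ a = 0"
proof -
  have "(\<Sum>k\<in>{1..n}. summand n S x k $ a) = 0"
    using arg_cong[OF sum_summand[OF x], of "\<lambda>v. v $ a"] a by simp
  moreover have "\<And>k. k \<in> {1..n} \<Longrightarrow> 0 \<le> summand n S x k $ a"
    using summand_in_simplex[OF x] by (auto simp: face_hull_coords)
  ultimately show ?thesis using k by (subst (asm) sum_nonneg_eq_0_iff) auto
qed

lemma reweight_diff:
  "reweight n S lam x - reweight n S lam y
     = (\<Sum>k\<in>{1..n}. lam k *\<^sub>R (summand n S x k - summand n S y k))"
  by (simp add: reweight_def sum_subtractf scaleR_diff_right)

lemma reweight_one: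
  assumes "x \<in> scaled_simplex (real n)" and "\<And>k. k \<in> {1..n} \<Longrightarrow> lam k = 1"
  shows "reweight n S lam x = x"
proof -
  have "reweight n S lam x = (\<Sum>k\<in>{1..n}. summand n S x k)"
    unfolding reweight_def by (rule sum.cong) (use assms in auto)
  then show ?thesis using sum_summand[OF assms(1)] by simp
qed

text \<open>
  The vector \<open>lam k * (p\<^sub>k(x) - p\<^sub>k(y))\<close> is the image of the difference of the reweighted points under
  a linear projection that depends on the cell and on \<open>k\<close> only. So one constant serves all weights, which is
  essential when the weights tend to 0.
\<close>
lemma cellwise_bound:
  obtains c where "c \<ge> 0"
    and "\<And>P x y lam k. P \<in> max_cells S \<Longrightarrow> x \<in> P \<Longrightarrow> y \<in> P \<Longrightarrow> k \<in> {1..n} \<Longrightarrow>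
       \<bar>lam k\<bar> * norm (summand n S x k - summand n S y k)
         \<le> c * norm (reweight n S lam x - reweight n S lam y)"
proof -
  have "\<exists>b>0. \<forall>x\<in>P. \<forall>y\<in>P. \<forall>lam.
       \<bar>lam k\<bar> * norm (summand n S x k - summand n S y k)
         \<le> b * norm (reweight n S lam x - reweight n S lam y)"
    if P: "P \<in> max_cells S" and k: "k \<in> {1..n}" for P k
  proof -
    obtain F where F: "linear (F k)"
      "\<And>v. (\<forall>j\<in>{1..n}. v j \<in> face_directions (label S P j)) \<Longrightarrow> F k (\<Sum>j\<in>{1..n}. v j) = v k"
      using max_cell_projection[OF P] k by blast
    obtain b where b: "b > 0" "\<And>z. norm (F k z) \<le> b * norm z"
      using linear_bounded_pos[OF F(1)] by blast
    have "\<bar>lam k\<bar> * norm (summand n S x k - summand n S y k)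
         \<le> b * norm (reweight n S lam x - reweight n S lam y)" if xy: "x \<in> P" "y \<in> P" for x y lam
    proof -
      have "F k (reweight n S lam x - reweight n S lam y)
          = lam k *\<^sub>R (summand n S x k - summand n S y k)"
        unfolding reweight_diff
        by (rule F(2)[of "\<lambda>k. lam k *\<^sub>R (summand n S x k - summand n S y k)"])
          (use xy summand_in_label[OF max_cell_in_cells[OF P]] in
            \<open>blast intro: scale_face_directions face_hull_diff\<close>)
      then show ?thesis using b(2)[of "reweight n S lam x - reweight n S lam y"] by simp
    qed
    then show ?thesis using b(1) by blast
  qed
  then obtain b where b: "\<And>P k. P \<in> max_cells S \<Longrightarrow> k \<in> {1..n} \<Longrightarrow> b P k > 0"
    "\<And>P k x y lam. P \<in> max_cells S \<Longrightarrow> k \<in> {1..n} \<Longrightarrow> x \<in> P \<Longrightarrow> y \<in> P \<Longrightarrow>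
       \<bar>lam k\<bar> * norm (summand n S x k - summand n S y k)
         \<le> b P k * norm (reweight n S lam x - reweight n S lam y)"
    by metis
  define c where "c = (\<Sum>P\<in>max_cells S. \<Sum>k\<in>{1..n}. b P k)"
  have fin: "finite (max_cells S)" using subdivision by (simp add: fine_mixed_subdivision_def)
  have nonneg: "0 \<le> (\<Sum>k\<in>{1..n}. b P k)" if "P \<in> max_cells S" for P
    by (rule sum_nonneg) (use b(1)[OF that] in force)
  have bc: "b P k \<le> c" if P: "P \<in> max_cells S" and k: "k \<in> {1..n}" for P k
  proof -
    have "b P k \<le> (\<Sum>k\<in>{1..n}. b P k)"
      by (rule member_le_sum[OF k]) (use b(1)[OF P] in force)+
    also have "\<dots> \<le> c"
      unfolding c_def by (rule member_le_sum[OF P]) (use nonneg fin in auto)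
    finally show ?thesis .
  qed
  show ?thesis
  proof
    show "c \<ge> 0" unfolding c_def by (rule sum_nonneg) (rule nonneg)
    show "\<bar>lam k\<bar> * norm (summand n S x k - summand n S y k)
         \<le> c * norm (reweight n S lam x - reweight n S lam y)"
      if "P \<in> max_cells S" "x \<in> P" "y \<in> P" "k \<in> {1..n}" for P x y lam k
      using b(2)[OF that(1,4,2,3), of lam] mult_right_mono[OF bc[OF that(1,4)] norm_ge_zero]
      by (rule order_trans)
  qed
qed

lemma continuous_on_summand:
  assumes k: "k \<in> {1..n}"
  shows "continuous_on (scaled_simplex (real n)) (\<lambda>x. summand n S x k)"
proof -
  obtain c where c: "c \<ge> 0"
    "\<And>P x y lam. P \<in> max_cells S \<Longrightarrow> x \<in> P \<Longrightarrow> y \<in> P \<Longrightarrow>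
       \<bar>lam k\<bar> * norm (summand n S x k - summand n S y k)
         \<le> c * norm (reweight n S lam x - reweight n S lam y)"
    using cellwise_bound k by metis
  have "continuous_on (\<Union>P\<in>max_cells S. P) (\<lambda>x. summand n S x k)"
  proof (rule continuous_on_closed_Union)
    show "finite (max_cells S)" using subdivision by (simp add: fine_mixed_subdivision_def)
    fix P assume P: "P \<in> max_cells S"
    show "closed P" using max_cell_nonempty_compact_convex(2)[OF P] compact_imp_closed by blast
    have sub: "P \<subseteq> scaled_simplex (real n)" using P Union_max_cells by blast
    have "c-lipschitz_on P (\<lambda>x. summand n S x k)"
    proof (rule lipschitz_onI[OF _ c(1)])
      fix x y assume xy: "x \<in> P" "y \<in> P"
      then show "dist (summand n S x k) (summand n S y k) \<le> c * dist x y"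
        using c(2)[OF P xy, of "\<lambda>_. 1"] sub by (simp add: dist_norm reweight_one subset_iff)
    qed
    then show "continuous_on P (\<lambda>x. summand n S x k)" by (rule lipschitz_on_continuous_on)
  qed
  then show ?thesis using Union_max_cells by simp
qed

lemma continuous_on_reweight: "continuous_on (scaled_simplex (real n)) (reweight n S lam)"
  unfolding reweight_def by (intro continuous_intros continuous_on_summand)

lemma reweight_in_simplex:
  assumes lam: "\<And>k. k \<in> {1..n} \<Longrightarrow> 0 \<le> lam k" and x: "x \<in> scaled_simplex (real n)"
  shows "reweight n S lam x \<in> scaled_simplex (\<Sum>k\<in>{1..n}. lam k)"
proof -
  have "(\<Sum>a\<in>UNIV. reweight n S lam x $ a) = (\<Sum>k\<in>{1..n}. lam k * (\<Sum>a\<in>UNIV. summand n S x k $ a))"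
    by (simp add: reweight_def sum_distrib_left sum.swap[of _ UNIV])
  also have "\<dots> = (\<Sum>k\<in>{1..n}. lam k)"
    by (rule sum.cong) (use summand_in_simplex[OF x] in \<open>auto simp: face_hull_coords\<close>)
  finally show ?thesis
    using summand_in_simplex[OF x] lam
    by (auto simp: scaled_simplex_def reweight_def face_hull_coords intro!: sum_nonneg)
qed

lemma reweight_surj:
  assumes lam: "\<And>k. k \<in> {1..n} \<Longrightarrow> 0 \<le> lam k"
  shows "reweight n S lam ` scaled_simplex (real n) = scaled_simplex (\<Sum>k\<in>{1..n}. lam k)"
proof
  show "reweight n S lam ` scaled_simplex (real n) \<subseteq> scaled_simplex (\<Sum>k\<in>{1..n}. lam k)"
    using reweight_in_simplex lam by blast
  show "scaled_simplex (\<Sum>k\<in>{1..n}. lam k) \<subseteq> reweight n S lam ` scaled_simplex (real n)"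
  proof (rule face_preserving_surj[OF _ continuous_on_reweight reweight_in_simplex])
    fix x :: "real^'d" and a assume "x \<in> scaled_simplex (real n)" "x $ a = 0"
    then show "reweight n S lam x $ a = 0" using summand_support by (simp add: reweight_def)
  qed (use lam n_pos in auto)
qed

section \<open>Rigidity\<close>

text \<open>
  The images of the cells cover a convex set, the dilated simplex of the new size, since
  reweighting is onto. On it the inverse of the reweighting is defined, and the bound on the cells is
  a Lipschitz bound for the scaled summand as a function of the reweighted point.
\<close>
lemma global_bound_of_injective:
  assumes c: "c \<ge> 0"
    and cell: "\<And>P x y k. P \<in> max_cells S \<Longrightarrow> x \<in> P \<Longrightarrow> y \<in> P \<Longrightarrow> k \<in> {1..n} \<Longrightarrow>
       \<bar>lam k\<bar> * norm (summand n S x k - summand n S y k)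
         \<le> c * norm (reweight n S lam x - reweight n S lam y)"
    and lam: "\<And>k. k \<in> {1..n} \<Longrightarrow> 0 < lam k"
    and inj: "inj_on (reweight n S lam) (scaled_simplex (real n))"
    and x: "x \<in> scaled_simplex (real n)" and y: "y \<in> scaled_simplex (real n)" and k: "k \<in> {1..n}"
  shows "lam k * norm (summand n S x k - summand n S y k)
         \<le> c * norm (reweight n S lam x - reweight n S lam y)"
proof -
  let ?D = "scaled_simplex (real n) :: (real^'d) set" and ?f = "reweight n S lam"
  let ?E = "scaled_simplex (\<Sum>k\<in>{1..n}. lam k) :: (real^'d) set"
  define g where "g = the_inv_into ?D ?f"
  define h where "h u = lam k *\<^sub>R summand n S (g u) k" for u
  have gf: "g (?f z) = z" if "z \<in> ?D" for z
    unfolding g_def by (rule the_inv_into_f_f[OF inj that])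
  have fD: "?f ` ?D = ?E" by (rule reweight_surj) (use lam in \<open>simp add: less_imp_le\<close>)
  have PD: "P \<subseteq> ?D" if "P \<in> max_cells S" for P using that Union_max_cells by blast
  have "c-lipschitz_on ?E h"
  proof (rule lipschitz_on_convex_closed_cover[where Q = "(`) ?f ` max_cells S"])
    show "convex ?E" by (rule convex_scaled_simplex)
    show "finite ((`) ?f ` max_cells S)" using subdivision by (simp add: fine_mixed_subdivision_def)
    have "?E = (\<Union>P\<in>max_cells S. ?f ` P)" unfolding fD[symmetric] Union_max_cells[symmetric] by blast
    then show "?E \<subseteq> \<Union> ((`) ?f ` max_cells S)" by simp
  next
    fix q assume "q \<in> (`) ?f ` max_cells S"
    then obtain P where P: "P \<in> max_cells S" "q = ?f ` P" by blast
    have "compact q"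
      unfolding P(2) by (intro compact_continuous_image continuous_on_subset[OF continuous_on_reweight]
          PD P(1) max_cell_nonempty_compact_convex)
    then show "closed q" by (rule compact_imp_closed)
    show "c-lipschitz_on q h"
    proof (rule lipschitz_onI[OF _ c])
      fix u v assume "u \<in> q" "v \<in> q"
      then obtain s t where st: "s \<in> P" "t \<in> P" "u = ?f s" "v = ?f t" using P(2) by blast
      have "dist (h u) (h v) = \<bar>lam k\<bar> * norm (summand n S s k - summand n S t k)"
        using st gf PD[OF P(1)] by (simp add: h_def dist_norm subset_iff flip: scaleR_diff_right)
      then show "dist (h u) (h v) \<le> c * dist u v"
        using cell[OF P(1) st(1,2) k] st by (simp add: dist_norm)
    qed
  qed (rule c)
  then have "dist (h (?f x)) (h (?f y)) \<le> c * dist (?f x) (?f y)"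
    by (rule lipschitz_onD) (use x y fD in blast)+
  then show ?thesis
    using gf x y lam[OF k] by (simp add: h_def dist_norm flip: scaleR_diff_right)
qed

text \<open>
  The reweighted differences for \<open>lam\<close> and \<open>mu\<close> differ by less than the one for \<open>lam\<close> itself, so if one
  vanishes, then both do. The distance \<open>\<delta>\<close> is relative to the size of the weights and independent of
  \<open>lam\<close>, which allows infinitely many steps towards weight 0.
\<close>
lemma injective_of_nearby_injective:
  assumes bound: "\<And>x y k. x \<in> scaled_simplex (real n) \<Longrightarrow> y \<in> scaled_simplex (real n) \<Longrightarrow>
      k \<in> {1..n} \<Longrightarrow> lam k * norm (summand n S x k - summand n S y k)
         \<le> c * norm (reweight n S lam x - reweight n S lam y)"
    and lam: "\<And>k. k \<in> {1..n} \<Longrightarrow> 0 < lam k"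
    and inj: "inj_on (reweight n S lam) (scaled_simplex (real n))"
    and near: "\<And>k. k \<in> {1..n} \<Longrightarrow> \<bar>lam k - mu k\<bar> \<le> \<delta> * lam k"
    and small: "real n * \<delta> * c < 1" and \<delta>: "\<delta> \<ge> 0"
  shows "inj_on (reweight n S mu) (scaled_simplex (real n))"
proof (rule inj_onI)
  fix x y assume xy: "x \<in> scaled_simplex (real n)" "y \<in> scaled_simplex (real n)"
    and eq: "reweight n S mu x = reweight n S mu y"
  let ?w = "\<lambda>k. summand n S x k - summand n S y k"
  let ?z = "reweight n S lam x - reweight n S lam y"
  have "?z = ?z - (reweight n S mu x - reweight n S mu y)" using eq by simp
  also have "\<dots> = (\<Sum>k\<in>{1..n}. (lam k - mu k) *\<^sub>R ?w k)"
    by (simp add: reweight_diff sum_subtractf scaleR_left_diff_distrib)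
  finally have z: "?z = (\<Sum>k\<in>{1..n}. (lam k - mu k) *\<^sub>R ?w k)" .
  have "norm ?z \<le> (\<Sum>k\<in>{1..n}. \<delta> * (c * norm ?z))"
    unfolding z
  proof (rule sum_norm_le, fold z)
    fix k assume k: "k \<in> {1..n}"
    have "norm ((lam k - mu k) *\<^sub>R ?w k) \<le> (\<delta> * lam k) * norm (?w k)"
      using near[OF k] by (simp add: mult_right_mono)
    also have "\<dots> \<le> \<delta> * (c * norm ?z)"
      using mult_left_mono[OF bound[OF xy k] \<delta>] by (simp add: mult.assoc)
    finally show "norm ((lam k - mu k) *\<^sub>R ?w k) \<le> \<delta> * (c * norm ?z)" .
  qed
  then have "norm ?z \<le> (real n * \<delta> * c) * norm ?z" by (simp add: mult_ac)
  then have "norm ?z * (1 - real n * \<delta> * c) \<le> 0" by (simp add: algebra_simps)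
  then have "norm ?z \<le> 0" using small by (simp add: mult_le_0_iff)
  then show "x = y" using inj xy by (simp add: inj_on_def)
qed

text \<open>
  Let the weights be 1 on \<open>K\<close> and \<open>\<theta>\<^sup>m\<close> elsewhere. Passing from \<open>m\<close> to \<open>m + 1\<close> changes every weight by
  at most the relative amount \<open>1 - \<theta>\<close>, so injectivity propagates from \<open>m = 0\<close>, where reweighting is
  the identity. If the sums over \<open>K\<close> agree, the difference of the reweighted points is a multiple of
  \<open>\<theta>\<^sup>m\<close>, and the global bound lets the differences of the summands in \<open>K\<close> tend to 0.
\<close>
lemma partial_sum_determines_summands:
  assumes K: "K \<subseteq> {1..n}"
    and x: "x \<in> scaled_simplex (real n)" and y: "y \<in> scaled_simplex (real n)"
    and eq: "(\<Sum>k\<in>K. summand n S x k) = (\<Sum>k\<in>K. summand n S y k)" and k: "k \<in> K"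
  shows "summand n S x k = summand n S y k"
proof -
  obtain c where c: "c \<ge> 0"
    "\<And>P x y lam k. P \<in> max_cells S \<Longrightarrow> x \<in> P \<Longrightarrow> y \<in> P \<Longrightarrow> k \<in> {1..n} \<Longrightarrow>
       \<bar>lam k\<bar> * norm (summand n S x k - summand n S y k)
         \<le> c * norm (reweight n S lam x - reweight n S lam y)"
    using cellwise_bound by metis
  \<comment> \<open>Any value in \<open>(0, 1)\<close> with \<open>n (1 - \<theta>) c < 1\<close> would do; adding 2 makes it positive even if \<open>c = 0\<close>.\<close>
  define \<theta> where "\<theta> = 1 - 1 / (real n * c + 2)"
  have "0 \<le> real n * c" using c(1) by simp
  then have nc: "real n * c + 2 > 0" "real n * c + 1 > 0" by linarith+
  have \<theta>: "0 < \<theta>" "\<theta> < 1" "real n * (1 - \<theta>) * c < 1"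
    using nc by (simp_all add: \<theta>_def field_simps)
  define lam where "lam m j = (if j \<in> K then 1 else \<theta> ^ m)" for m :: nat and j :: nat
  have lam: "0 < lam m j" for m j using \<theta>(1) by (simp add: lam_def)
  have bound: "lam m j * norm (summand n S u j - summand n S v j)
        \<le> c * norm (reweight n S (lam m) u - reweight n S (lam m) v)"
    if "inj_on (reweight n S (lam m)) (scaled_simplex (real n))"
      "u \<in> scaled_simplex (real n)" "v \<in> scaled_simplex (real n)" "j \<in> {1..n}" for m u v j
    by (rule global_bound_of_injective[where lam = "lam m", OF c(1) _ lam that])
      (rule c(2)[where lam = "lam m"]; assumption)
  have inj: "inj_on (reweight n S (lam m)) (scaled_simplex (real n))" for m
  proof (induction m)
    case 0
    have "reweight n S (lam 0) u = u" if "u \<in> scaled_simplex (real n)" for u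
      by (rule reweight_one[OF that]) (simp add: lam_def)
    then show ?case by (simp add: inj_on_def)
  next
    case (Suc m)
    show ?case
    proof (rule injective_of_nearby_injective[OF bound[OF Suc] lam Suc])
      show "\<bar>lam m j - lam (Suc m) j\<bar> \<le> (1 - \<theta>) * lam m j" for j
        using \<theta>(1,2) by (simp add: lam_def abs_if algebra_simps)
    qed (use \<theta> in auto)
  qed
  let ?w = "\<lambda>j. summand n S x j - summand n S y j"
  let ?Z = "\<Sum>j\<in>{1..n} - K. ?w j"
  have "norm (?w k) \<le> c * norm ?Z * \<theta> ^ m" for m
  proof -
    have "reweight n S (lam m) x - reweight n S (lam m) y
        = (\<Sum>j\<in>{1..n} - K. lam m j *\<^sub>R ?w j) + (\<Sum>j\<in>K. lam m j *\<^sub>R ?w j)"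
      unfolding reweight_diff by (rule sum.subset_diff[OF K]) simp
    also have "(\<Sum>j\<in>K. lam m j *\<^sub>R ?w j) = 0" using eq by (simp add: lam_def sum_subtractf)
    also have "(\<Sum>j\<in>{1..n} - K. lam m j *\<^sub>R ?w j) = \<theta> ^ m *\<^sub>R ?Z"
      unfolding scaleR_sum_right by (rule sum.cong) (auto simp: lam_def)
    finally have "norm (reweight n S (lam m) x - reweight n S (lam m) y) = \<theta> ^ m * norm ?Z"
      using \<theta>(1) by simp
    then show ?thesis using bound[OF inj x y, of k m] k K by (auto simp: lam_def mult_ac)
  qed
  moreover have "(\<lambda>m. c * norm ?Z * \<theta> ^ m) \<longlonglongrightarrow> c * norm ?Z * 0"
    using \<theta> by (intro tendsto_intros LIMSEQ_realpow_zero) auto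
  ultimately have "norm (?w k) \<le> c * norm ?Z * 0" by (intro LIMSEQ_le_const) auto
  then show ?thesis by simp
qed

section \<open>Cells over a face\<close>

text \<open>
  Give \<open>i\<close> the weight 1 and the other indices the weight \<open>\<delta>\<close>, and let the reweighted sum of the
  summands of \<open>x\<close> be the barycenter of the face \<open>A\<close> of the target. Then all summands of \<open>x\<close> are supported
  in \<open>A\<close>, so every label meets \<open>A\<close>. The summands with weight \<open>\<delta>\<close> contribute too little to any coordinate
  of the barycenter, so the \<open>i\<close>-th summand is positive on all of \<open>A\<close>.
\<close>
lemma cell_over_face:
  assumes A: "A \<noteq> {}" and i: "i \<in> {1..n}"
  obtains P where "P \<in> max_cells S" "A \<subseteq> label S P i" "\<And>j. j \<in> {1..n} \<Longrightarrow> label S P j \<inter> A \<noteq> {}"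
proof -
  define d where "d = real CARD('d)"
  have d: "d > 0" by (simp add: d_def)
  \<comment> \<open>The other \<open>n - 1\<close> summands then contribute less than \<open>1 / d\<close>, a lower bound for the coordinates
      of the barycenter on \<open>A\<close>.\<close>
  define \<delta> where "\<delta> = 1 / (real n * d)"
  have \<delta>: "\<delta> > 0" using n_pos d by (simp add: \<delta>_def)
  define lam where "lam k = (if k = i then 1 else \<delta>)" for k :: nat
  have lam: "0 < lam k" for k using \<delta> by (simp add: lam_def)
  define m where "m = (\<Sum>k\<in>{1..n}. lam k)"
  have "m = 1 + (\<Sum>k\<in>{1..n} - {i}. lam k)"
    unfolding m_def using i by (subst sum.remove[of _ i]) (auto simp: lam_def)
  then have m1: "m \<ge> 1" using lam by (simp add: sum_nonneg less_imp_le)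
  have cA: "0 < real (card A)" "real (card A) \<le> d"
    using A by (auto simp: d_def card_gt_0_iff intro!: card_mono)
  define y :: "real^'d" where "y = (\<chi> a. if a \<in> A then m / real (card A) else 0)"
  have "(\<Sum>a\<in>UNIV. y $ a) = m" using cA A by (simp add: y_def sum.If_cases)
  then have "y \<in> scaled_simplex m" using m1 cA by (auto simp: scaled_simplex_def y_def)
  then obtain x where x: "x \<in> scaled_simplex (real n)" and y: "y = reweight n S lam x"
    using reweight_surj[of lam] lam unfolding m_def by (metis image_iff less_imp_le)
  obtain P where P: "P \<in> max_cells S" "x \<in> P"
    using simplex_in_max_cell[OF x] by blast
  define p where "p = summand n S x"
  have p: "p k \<in> face_hull (label S P k)" if "k \<in> {1..n}" for k
    unfolding p_def
    by (rule summand_in_label[OF max_cell_in_cells[OF P(1)] P(2) that])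
  have ya: "y $ a = (\<Sum>k\<in>{1..n}. lam k * p k $ a)" for a
    by (simp add: y reweight_def p_def)
  have p0: "0 \<le> p k $ a" "p k $ a \<le> 1" if "k \<in> {1..n}" for k a
    using p[OF that] face_hull_le_1 by (auto simp: face_hull_coords)
  have meets: "label S P j \<inter> A \<noteq> {}" if j: "j \<in> {1..n}" for j
  proof -
    have "(\<Sum>a\<in>UNIV. p j $ a) \<noteq> 0" using p[OF j] by (simp add: face_hull_coords)
    then obtain s where s: "p j $ s \<noteq> 0" by (meson sum.neutral)
    have "lam j * p j $ s \<le> y $ s"
      unfolding ya by (rule member_le_sum[OF j]) (use p0 lam in \<open>auto simp: less_imp_le\<close>)
    moreover have "0 < lam j * p j $ s" using s p0(1)[OF j, of s] lam[of j] by simp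
    ultimately have "s \<in> A" by (auto simp: y_def split: if_splits)
    moreover have "s \<in> label S P j" using s p[OF j] by (auto simp: face_hull_coords)
    ultimately show ?thesis by blast
  qed
  have "A \<subseteq> label S P i"
  proof
    fix a assume a: "a \<in> A"
    have "y $ a = p i $ a + (\<Sum>k\<in>{1..n} - {i}. \<delta> * p k $ a)"
      unfolding ya using i by (subst sum.remove[of _ i]) (auto simp: lam_def intro!: sum.cong)
    also have "(\<Sum>k\<in>{1..n} - {i}. \<delta> * p k $ a) \<le> (\<Sum>k\<in>{1..n} - {i}. \<delta>)"
      by (rule sum_mono) (use p0(2) \<delta> in auto)
    also have "\<dots> = (real n - 1) * \<delta>" using i n_pos by (simp add: of_nat_diff)
    also have "\<dots> < real n * \<delta>" using \<delta> by simp
    also have "real n * \<delta> = 1 / d" using n_pos by (simp add: \<delta>_def)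
    also have "1 / d \<le> m / real (card A)" using m1 cA d by (intro frac_le) auto
    also have "\<dots> = y $ a" using a by (simp add: y_def)
    finally have "p i $ a > 0" by simp
    moreover have "a \<notin> label S P i \<longrightarrow> p i $ a = 0" using p[OF i] by (simp add: face_hull_coords)
    ultimately show "a \<in> label S P i" by (metis less_irrefl)
  qed
  with that P(1) meets show ?thesis by blast
qed

section \<open>Edges and the system of permutations\<close>

text \<open>
  Take a maximal cell through the midpoint \<open>x\<close> of the expected segment and intersect it with the edge.
  The result is a face, so a labeled cell. By uniqueness of summands at most one label is the full
  edge, and since \<open>x\<close> is not a lattice point, exactly one is. The position of \<open>x\<close> fixes the other
  counts.
\<close>
lemma edge_cell_exists:
  assumes ab: "a \<noteq> b" and r: "r \<in> {1..n}"
  shows "\<exists>F. F \<in> cells S \<and> card {k\<in>{1..n}. label S F k = {b}} = r - 1 \<and>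
     card {k\<in>{1..n}. label S F k = {a}} = n - r \<and> card {k\<in>{1..n}. label S F k = {a, b}} = 1"
proof -
  define x :: "real^'d" where
    "x = (real n - real r + 1/2) *\<^sub>R axis a 1 + (real r - 1/2) *\<^sub>R axis b 1"
  have xc: "x $ c = (if c = a then real n - real r + 1/2 else if c = b then real r - 1/2 else 0)" for c
    using ab by (simp add: x_def axis_def)
  have "(\<Sum>c\<in>UNIV. x $ c) = real n"
    by (simp add: x_def sum.distrib sum_axis flip: sum_distrib_left)
  moreover have "0 \<le> x $ c" for c using r by (simp add: xc)
  ultimately have xD: "x \<in> scaled_simplex (real n)" by (simp add: scaled_simplex_def)
  then obtain P where P: "P \<in> max_cells S" "x \<in> P"
    using simplex_in_max_cell by blast
  define F where "F = {z \<in> P. \<forall>c. c \<noteq> a \<and> c \<noteq> b \<longrightarrow> z $ c = 0}"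
  have PD: "0 \<le> z $ c" if "z \<in> P" for z c
    using that P(1) Union_max_cells by (auto simp: scaled_simplex_def)
  have "F face_of P"
    unfolding face_of_def
  proof (intro conjI ballI impI)
    show "F \<subseteq> P" by (auto simp: F_def)
    show "convex F"
      using max_cell_nonempty_compact_convex(3)[OF P(1)]
      by (auto simp: F_def convex_def)
    fix u v z assume uv: "u \<in> P" "v \<in> P" and z: "z \<in> F" "z \<in> open_segment u v"
    then obtain t where t: "0 < t" "t < 1" "z = (1 - t) *\<^sub>R u + t *\<^sub>R v"
      by (auto simp: in_segment)
    have "u $ c = 0 \<and> v $ c = 0" if c: "c \<noteq> a" "c \<noteq> b" for c
    proof -
      have "(1 - t) * u $ c + t * v $ c = 0" using z(1) c t(3) by (auto simp: F_def)
      moreover have "0 \<le> (1 - t) * u $ c" "0 \<le> t * v $ c" using t PD uv by auto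
      ultimately have "(1 - t) * u $ c = 0" "t * v $ c = 0" by linarith+
      then show ?thesis using t by simp
    qed
    then show "u \<in> F" "v \<in> F" using uv by (auto simp: F_def)
  qed
  moreover have xF: "x \<in> F" using P(2) by (simp add: F_def xc)
  ultimately have FC: "F \<in> cells S" using P(1) by (auto simp: cells_def)
  let ?L = "label S F"
  have ne: "?L k \<noteq> {}" if "k \<in> {1..n}" for k using label_nonempty[OF FC that] .
  have vertex: "(\<Sum>k\<in>{1..n}. axis (g k) 1) \<in> F" if "\<And>k. k \<in> {1..n} \<Longrightarrow> g k \<in> ?L k" for g
    unfolding cell_iff[OF FC]
    by (rule exI[of _ "\<lambda>k. axis (g k) 1"]) (use that axis_in_face_hull in blast)
  have Lsub: "?L k \<subseteq> {a, b}" if k: "k \<in> {1..n}" for k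
  proof
    fix c assume c: "c \<in> ?L k"
    \<comment> \<open>A vertex of \<open>F\<close> that uses \<open>c\<close> has a positive \<open>c\<close>-th coordinate.\<close>
    define g where "g j = (if j = k then c else SOME e. e \<in> ?L j)" for j
    have "g j \<in> ?L j" if "j \<in> {1..n}" for j using ne[OF that] c by (auto simp: g_def some_in_eq)
    then have "(\<Sum>j\<in>{1..n}. axis (g j) (1::real)) \<in> F" by (rule vertex)
    moreover have "(axis (g k) (1::real) :: real^'d) $ c \<le> (\<Sum>j\<in>{1..n}. axis (g j) 1) $ c"
      unfolding sum_component by (rule member_le_sum[OF k]) (auto simp: axis_def)
    ultimately show "c \<in> {a, b}" by (auto simp: F_def g_def)
  qed
  have atmost1: "j = k" if j: "j \<in> {1..n}" "?L j = {a, b}" and k: "k \<in> {1..n}" "?L k = {a, b}" for j k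
  proof (rule ccontr)
    assume "j \<noteq> k"
    \<comment> \<open>Exchanging the end points in two full edges does not change the sum.\<close>
    define g where "g e = (if e = j then a else if e = k then b else SOME c. c \<in> ?L e)" for e
    define h where "h e = (if e = j then b else if e = k then a else SOME c. c \<in> ?L e)" for e
    have g: "\<forall>e\<in>{1..n}. axis (g e) 1 \<in> face_hull (?L e)"
      using ne j k by (auto simp: g_def some_in_eq intro!: axis_in_face_hull)
    have h: "\<forall>e\<in>{1..n}. axis (h e) 1 \<in> face_hull (?L e)"
      using ne j k by (auto simp: h_def some_in_eq intro!: axis_in_face_hull)
    have split: "(\<Sum>e\<in>{1..n}. f e) = (\<Sum>e\<in>{1..n} - {j, k}. f e) + (f j + f k)" for f :: "nat \<Rightarrow> real^'d"
      using sum.subset_diff[of "{j, k}" "{1..n}" f] j k \<open>j \<noteq> k\<close> by simp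
    have "(\<Sum>e\<in>{1..n} - {j, k}. axis (g e) 1) = (\<Sum>e\<in>{1..n} - {j, k}. axis (h e) (1::real))"
      by (rule sum.cong) (auto simp: g_def h_def)
    then have eq: "(\<Sum>e\<in>{1..n}. axis (g e) 1) = (\<Sum>e\<in>{1..n}. axis (h e) (1::real))"
      unfolding split using \<open>j \<noteq> k\<close> by (simp add: g_def h_def add.commute)
    have "axis (g j) (1::real) = axis (h j) 1"
      using summand_eq[OF FC g refl j(1)] summand_eq[OF FC h eq j(1)]
      by simp
    then show False using ab by (simp add: g_def h_def axis_eq_axis)
  qed
  let ?A = "{k\<in>{1..n}. ?L k = {a}}" and ?B = "{k\<in>{1..n}. ?L k = {b}}"
    and ?C = "{k\<in>{1..n}. ?L k = {a, b}}"
  have part: "{1..n} = (?A \<union> ?B) \<union> ?C"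
  proof -
    have "?L k = {a} \<or> ?L k = {b} \<or> ?L k = {a, b}" if "k \<in> {1..n}" for k
      using Lsub[OF that] ne[OF that] by auto
    then have "k \<in> {1..n} \<longleftrightarrow> k \<in> (?A \<union> ?B) \<union> ?C" for k
      by (simp only: Un_iff mem_Collect_eq) blast
    then show ?thesis by blast
  qed
  have disj: "?A \<inter> ?B = {}" "(?A \<union> ?B) \<inter> ?C = {}" using ab by auto
  have "card {1..n} = card (?A \<union> ?B) + card ?C"
    by (subst part, rule card_Un_disjoint) (use disj in auto)
  also have "card (?A \<union> ?B) = card ?A + card ?B"
    by (rule card_Un_disjoint) (use disj in auto)
  finally have cn: "n = card ?A + card ?B + card ?C" by simp
  have c1: "card ?C \<le> 1" by (rule card_le_Suc0_iff_eq[THEN iffD2, unfolded One_nat_def[symmetric]])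
      (use atmost1 in auto)
  obtain q where q: "\<forall>k\<in>{1..n}. q k \<in> face_hull (?L k)" "x = (\<Sum>k\<in>{1..n}. q k)"
    using xF cell_iff[OF FC] by blast
  have "x $ b = (\<Sum>k\<in>{1..n}. q k $ b)" by (simp add: q(2))
  also have "\<dots> = (\<Sum>k\<in>?A \<union> ?B. q k $ b) + (\<Sum>k\<in>?C. q k $ b)"
    by (subst part, rule sum.union_disjoint) (use disj in auto)
  also have "(\<Sum>k\<in>?A \<union> ?B. q k $ b) = (\<Sum>k\<in>?A. q k $ b) + (\<Sum>k\<in>?B. q k $ b)"
    by (rule sum.union_disjoint) (use disj in auto)
  also have "(\<Sum>k\<in>?A. q k $ b) = 0"
  proof (rule sum.neutral, rule ballI)
    fix k assume "k \<in> ?A"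
    then have "q k \<in> face_hull {a}" using q(1) by (metis (mono_tags, lifting) mem_Collect_eq)
    then show "q k $ b = 0" using ab by (simp add: face_hull_singleton axis_def)
  qed
  also have "(\<Sum>k\<in>?B. q k $ b) = (\<Sum>k\<in>?B. 1)"
  proof (rule sum.cong)
    fix k assume "k \<in> ?B"
    then have "q k \<in> face_hull {b}" using q(1) by (metis (mono_tags, lifting) mem_Collect_eq)
    then show "q k $ b = 1" by (simp add: face_hull_singleton)
  qed simp
  finally have xb: "real r - 1/2 = real (card ?B) + (\<Sum>k\<in>?C. q k $ b)"
    using ab xc[of b] by simp
  have "0 \<le> (\<Sum>k\<in>?C. q k $ b)" by (rule sum_nonneg) (use q in \<open>auto simp: face_hull_coords\<close>)
  moreover have "(\<Sum>k\<in>?C. q k $ b) \<le> (\<Sum>k\<in>?C. 1)"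
    by (rule sum_mono) (use q(1) face_hull_le_1 in blast)
  ultimately have bounds: "real (card ?B) \<le> real r - 1/2" "real r - 1/2 \<le> real (card ?B) + real (card ?C)"
    using xb by simp_all
  then have "card ?B < r" "r \<le> card ?B + card ?C" by linarith+
  then have "card ?C = 1" "card ?B = r - 1" using c1 by linarith+
  moreover from this have "card ?A = n - r" using cn r by auto
  ultimately show ?thesis using FC by blast
qed

text \<open>
  By symmetry the counts determine the cell: its points are those of one and the same unit segment,
  by \<open>edge_labels_sum\<close>.
\<close>
lemma edge_cell_subset:
  assumes ab: "a \<noteq> b" and r: "r \<in> {1..n}"
    and F: "F \<in> cells S" "card {k\<in>{1..n}. label S F k = {b}} = r - 1"
      "card {k\<in>{1..n}. label S F k = {a}} = n - r" "card {k\<in>{1..n}. label S F k = {a, b}} = 1"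
    and G: "G \<in> cells S" "card {k\<in>{1..n}. label S G k = {b}} = r - 1"
      "card {k\<in>{1..n}. label S G k = {a}} = n - r" "card {k\<in>{1..n}. label S G k = {a, b}} = 1"
  shows "F \<subseteq> G"
proof
  fix x assume "x \<in> F"
  then obtain q where q: "\<forall>k\<in>{1..n}. q k \<in> face_hull (label S F k)" "x = (\<Sum>k\<in>{1..n}. q k)"
    using cell_iff[OF F(1)] by blast
  obtain i where i0: "i \<in> {1..n}"
    "\<forall>k\<in>{1..n}. label S F k = {a, b} \<longleftrightarrow> k = i"
    "\<forall>k\<in>{1..n}. k \<noteq> i \<longrightarrow> label S F k = {a} \<or> label S F k = {b}"
    "\<forall>p. (\<forall>k\<in>{1..n}. p k \<in> face_hull (label S F k)) \<longrightarrow>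
       (\<Sum>k\<in>{1..n}. p k) = (real n - real r) *\<^sub>R axis a 1 + (real r - 1) *\<^sub>R axis b 1 + p i"
    using edge_labels_sum[OF ab r F(2-4)] by (elim bexE conjE) (rule that; assumption)
  note i = i0(1) i0(2)[rule_format] i0(3)[rule_format] and si = i0(4)[THEN spec, THEN mp]
  have xi: "x = (real n - real r) *\<^sub>R axis a 1 + (real r - 1) *\<^sub>R axis b 1 + q i"
    using si[OF q(1)] q(2) by simp
  obtain j where j0: "j \<in> {1..n}"
    "\<forall>k\<in>{1..n}. label S G k = {a, b} \<longleftrightarrow> k = j"
    "\<forall>k\<in>{1..n}. k \<noteq> j \<longrightarrow> label S G k = {a} \<or> label S G k = {b}"
    "\<forall>p. (\<forall>k\<in>{1..n}. p k \<in> face_hull (label S G k)) \<longrightarrow>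
       (\<Sum>k\<in>{1..n}. p k) = (real n - real r) *\<^sub>R axis a 1 + (real r - 1) *\<^sub>R axis b 1 + p j"
    using edge_labels_sum[OF ab r G(2-4)] by (elim bexE conjE) (rule that; assumption)
  note j = j0(1) j0(2)[rule_format] j0(3)[rule_format] and sj = j0(4)[THEN spec, THEN mp]
  define p where "p k = (if k = j then q i else if label S G k = {a} then axis a 1 else axis b 1)" for k
  have p: "\<forall>k\<in>{1..n}. p k \<in> face_hull (label S G k)"
  proof
    fix k assume k: "k \<in> {1..n}"
    have "q i \<in> face_hull {a, b}" using q(1)[rule_format, OF i(1)] i(2)[OF i(1)] by simp
    then show "p k \<in> face_hull (label S G k)"
      using j(2,3)[OF k] by (auto simp: p_def intro: axis_in_face_hull)
  qed
  have "x = (\<Sum>k\<in>{1..n}. p k)" using sj[OF p] xi by (simp add: p_def)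
  then show "x \<in> G" using p cell_iff[OF G(1)] by blast
qed

lemma edge_cell_properties:
  assumes ab: "a \<noteq> b" and r: "r \<in> {1..n}"
  defines "F \<equiv> edge_cell n S a b r"
  shows "F \<in> cells S" "card {k\<in>{1..n}. label S F k = {b}} = r - 1"
    "card {k\<in>{1..n}. label S F k = {a}} = n - r" "card {k\<in>{1..n}. label S F k = {a, b}} = 1"
proof -
  let ?Q = "\<lambda>F. F \<in> cells S \<and> card {k\<in>{1..n}. label S F k = {b}} = r - 1 \<and>
     card {k\<in>{1..n}. label S F k = {a}} = n - r \<and> card {k\<in>{1..n}. label S F k = {a, b}} = 1"
  have "\<exists>!F. ?Q F"
  proof (rule ex_ex1I)
    show "\<exists>F. ?Q F" by (rule edge_cell_exists[OF ab r])
    show "F = G" if "?Q F" "?Q G" for F G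
      using that by (intro subset_antisym edge_cell_subset[OF ab r]) simp_all
  qed
  then have "?Q F" unfolding F_def edge_cell_def by (rule theI')
  then show "F \<in> cells S" "card {k\<in>{1..n}. label S F k = {b}} = r - 1"
    "card {k\<in>{1..n}. label S F k = {a}} = n - r" "card {k\<in>{1..n}. label S F k = {a, b}} = 1"
    by simp_all
qed

text \<open>
  On the \<open>r\<close>-th segment only the summand \<open>perm_system n S a b r\<close> moves, from \<open>w\<^sub>a\<close> to \<open>w\<^sub>b\<close>; \<open>B\<close> is the set
  of summands that have moved before.
\<close>
lemma edge_step:
  assumes ab: "a \<noteq> b" and r: "r \<in> {1..n}"
  obtains B where "perm_system n S a b r \<in> {1..n} - B" "B \<subseteq> {1..n}" "card B = r - 1"
    "\<And>k. k \<in> {1..n} \<Longrightarrow> summand n S (edge_point n a b (r - 1)) k = (if k \<in> B then axis b 1 else axis a 1)"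
    "\<And>k. k \<in> {1..n} \<Longrightarrow> summand n S (edge_point n a b r) k
       = (if k \<in> insert (perm_system n S a b r) B then axis b 1 else axis a 1)"
proof -
  define F where "F = edge_cell n S a b r"
  note F = edge_cell_properties[OF ab r, folded F_def]
  obtain j where j0: "j \<in> {1..n}"
    "\<forall>k\<in>{1..n}. label S F k = {a, b} \<longleftrightarrow> k = j"
    "\<forall>k\<in>{1..n}. k \<noteq> j \<longrightarrow> label S F k = {a} \<or> label S F k = {b}"
    "\<forall>p. (\<forall>k\<in>{1..n}. p k \<in> face_hull (label S F k)) \<longrightarrow>
       (\<Sum>k\<in>{1..n}. p k) = (real n - real r) *\<^sub>R axis a 1 + (real r - 1) *\<^sub>R axis b 1 + p j"
    using edge_labels_sum[OF ab r F(2-4)] by (elim bexE conjE) (rule that; assumption)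
  note j = j0(1) j0(2)[rule_format] j0(3)[rule_format] and sj = j0(4)[THEN spec, THEN mp]
  have perm: "perm_system n S a b r = j"
    unfolding perm_system_def F_def[symmetric] by (rule the_equality) (use j in auto)
  let ?B = "{k\<in>{1..n}. label S F k = {b}}"
  have "label S F j = {a, b}" using j(2)[OF j(1)] by simp
  then have jB: "j \<notin> ?B" using ab by auto
  have step: "summand n S ((real n - real r) *\<^sub>R axis a 1 + (real r - 1) *\<^sub>R axis b 1 + axis c 1) k
      = (if k \<in> ?B \<or> k = j \<and> c = b then axis b 1 else axis a 1)"
    if c: "c \<in> {a, b}" and k: "k \<in> {1..n}" for c k
  proof -
    define p :: "nat \<Rightarrow> real^'d" where
      "p k = (if k \<in> ?B \<or> k = j \<and> c = b then axis b 1 else axis a 1)" for k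
    have p: "\<forall>k\<in>{1..n}. p k \<in> face_hull (label S F k)"
    proof
      fix k assume k: "k \<in> {1..n}"
      show "p k \<in> face_hull (label S F k)"
        using j(2,3)[OF k] k by (auto simp: p_def intro!: axis_in_face_hull)
    qed
    have "p j = axis c 1" using c jB by (auto simp: p_def)
    then show ?thesis
      using summand_eq[OF F(1) p _ k] sj[OF p] by (simp add: p_def)
  qed
  have e0: "edge_point n a b (r - 1) = (real n - real r) *\<^sub>R axis a 1 + (real r - 1) *\<^sub>R axis b 1 + axis a 1"
    using r by (simp add: edge_point_def of_nat_diff algebra_simps)
  have e1: "edge_point n a b r = (real n - real r) *\<^sub>R axis a 1 + (real r - 1) *\<^sub>R axis b 1 + axis b 1"
    by (simp add: edge_point_def algebra_simps)
  show ?thesis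
  proof (rule that[of ?B])
    show "perm_system n S a b r \<in> {1..n} - ?B" using perm j(1) jB by simp
    show "card ?B = r - 1" by (rule F(2))
    show "summand n S (edge_point n a b (r - 1)) k = (if k \<in> ?B then axis b 1 else axis a 1)"
      if "k \<in> {1..n}" for k
      unfolding e0 step[OF insertI1 that] using ab by auto
    show "summand n S (edge_point n a b r) k
       = (if k \<in> insert (perm_system n S a b r) ?B then axis b 1 else axis a 1)"
      if "k \<in> {1..n}" for k
      unfolding e1 perm using step[OF _ that, of b] by auto
  qed auto
qed

lemma perm_system_in: "a \<noteq> b \<Longrightarrow> r \<in> {1..n} \<Longrightarrow> perm_system n S a b r \<in> {1..n}"
  using edge_step[of a b r] by blast

text \<open>
  At the lattice point shared by two consecutive edge cells the summands are the same, whichever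
  cell is used to compute them. So the indices moved in the first \<open>t\<close> segments are exactly those that
  have arrived at \<open>w\<^sub>b\<close>.
\<close>
lemma edge_prefix:
  assumes ab: "a \<noteq> b" and t: "t \<le> n" and k: "k \<in> {1..n}"
  shows "summand n S (edge_point n a b t) k
    = (if k \<in> perm_system n S a b ` {1..t} then axis b 1 else axis a 1)"
  using t k
proof (induction t arbitrary: k)
  case 0
  have r: "1 \<in> {1..n}" using n_pos by simp
  obtain B where B: "card B = 1 - 1" "B \<subseteq> {1..n}"
    "summand n S (edge_point n a b (1 - 1)) k = (if k \<in> B then axis b 1 else axis a 1)"
    using edge_step[OF ab r] 0(2) by metis
  have "finite B" using B(2) finite_subset by blast
  then have "B = {}" using B(1) by simp
  then show ?case using B(3) by simp
next
  case (Suc t)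
  have r: "Suc t \<in> {1..n}" using Suc.prems by simp
  obtain B where B: "B \<subseteq> {1..n}"
    "\<And>k. k \<in> {1..n} \<Longrightarrow> summand n S (edge_point n a b (Suc t - 1)) k = (if k \<in> B then axis b 1 else axis a 1)"
    "\<And>k. k \<in> {1..n} \<Longrightarrow> summand n S (edge_point n a b (Suc t)) k
       = (if k \<in> insert (perm_system n S a b (Suc t)) B then axis b 1 else axis a 1)"
    using edge_step[OF ab r] by metis
  have "B = perm_system n S a b ` {1..t}"
  proof -
    have "k \<in> B \<longleftrightarrow> k \<in> perm_system n S a b ` {1..t}" if "k \<in> {1..n}" for k
      using B(2)[OF that] Suc.IH[OF _ that] Suc.prems(1) ab by (auto simp: axis_eq_axis split: if_splits)
    moreover have "perm_system n S a b ` {1..t} \<subseteq> {1..n}"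
      using perm_system_in[OF ab] Suc.prems(1) by auto
    ultimately show ?thesis using B(1) by blast
  qed
  then show ?case using B(3)[OF Suc.prems(2)] by (simp add: atLeastAtMostSuc_conv)
qed

lemma perm_system_fresh:
  assumes ab: "a \<noteq> b" and s: "s \<in> {1..n}"
  shows "perm_system n S a b s \<notin> perm_system n S a b ` {1..s - 1}"
proof -
  obtain B where B: "perm_system n S a b s \<in> {1..n} - B"
    "\<And>k. k \<in> {1..n} \<Longrightarrow> summand n S (edge_point n a b (s - 1)) k = (if k \<in> B then axis b 1 else axis a 1)"
    using edge_step[OF ab s] by metis
  then have "axis a (1::real) = (if perm_system n S a b s \<in> perm_system n S a b ` {1..s - 1}
      then axis b 1 else axis a 1)"
    using edge_prefix[OF ab, of "s - 1" "perm_system n S a b s"] s by auto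
  then show ?thesis using ab by (auto simp: axis_eq_axis split: if_splits)
qed

lemma perm_system_permutes:
  assumes ab: "a \<noteq> b" shows "perm_system n S a b ` {1..n} = {1..n}"
proof (rule endo_inj_surj)
  show "inj_on (perm_system n S a b) {1..n}"
  proof (rule linorder_inj_onI)
    fix r s assume "r < s" "r \<in> {1..n}" "s \<in> {1..n}"
    then have "perm_system n S a b r \<in> perm_system n S a b ` {1..s - 1}" by (intro imageI) auto
    then show "perm_system n S a b r \<noteq> perm_system n S a b s"
      using perm_system_fresh[OF ab \<open>s \<in> {1..n}\<close>] by metis
  qed auto
qed (use perm_system_in[OF ab] in auto)

text \<open>
  If \<open>i\<close> is in position \<open>r\<close> and \<open>j\<close> comes later, the lattice point with index \<open>r\<close> lies after the move of \<open>i\<close>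
  and before the move of \<open>j\<close>.
\<close>
lemma graph_edge_point:
  assumes e: "(a, b) \<in> graph n (perm_system n S) i j"
  obtains x where "x \<in> scaled_simplex (real n)" "summand n S x i = axis b 1" "summand n S x j = axis a 1"
proof -
  obtain r s where rs: "a \<noteq> b" "r \<in> {1..n}" "s \<in> {1..n}" "r < s"
    "perm_system n S a b r = i" "perm_system n S a b s = j"
    using e by (auto simp: graph_def appears_before_def)
  have "j \<notin> perm_system n S a b ` {1..r}"
    using perm_system_fresh[OF rs(1,3)] rs by force
  moreover have "i \<in> perm_system n S a b ` {1..r}" using rs by auto
  moreover have "i \<in> {1..n}" "j \<in> {1..n}" using perm_system_in[OF rs(1)] rs by auto
  ultimately show ?thesis
    using that[of "edge_point n a b r"] edge_point_in_simplex[of r n a b] edge_prefix[OF rs(1), of r] rs(2)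
    by simp
qed

lemma graph_total:
  assumes ab: "a \<noteq> b" and ij: "i \<in> {1..n}" "j \<in> {1..n}" "i \<noteq> j"
  shows "(a, b) \<in> graph n (perm_system n S) i j \<or> (b, a) \<in> graph n (perm_system n S) i j"
proof -
  obtain r s where rs: "r \<in> {1..n}" "s \<in> {1..n}" "perm_system n S a b r = i" "perm_system n S a b s = j"
    using perm_system_permutes[OF ab] ij(1,2) by (metis imageE)
  show ?thesis
  proof (cases "r < s")
    case True
    then have "appears_before n (perm_system n S a b) i j"
      unfolding appears_before_def using rs by blast
    then show ?thesis using ab by (simp add: graph_def)
  next
    case False
    then have "n + 1 - r < n + 1 - s" "n + 1 - r \<in> {1..n}" "n + 1 - s \<in> {1..n}"
      using rs ij(3) by (auto simp: less_le)
    then have "appears_before n (perm_system n S b a) i j"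
      unfolding appears_before_def using perm_system_reverse[of _ n S b a] rs by metis
    then show ?thesis using ab by (auto simp: graph_def)
  qed
qed

section \<open>Sources of the graphs\<close>

text \<open>
  The edge yields a point \<open>x\<close> with \<open>p\<^sub>i(x) = w\<^sub>s\<close> and \<open>p\<^sub>j(x) = w\<^sub>b\<close>, the cell a point \<open>y\<close> with the two
  vertices exchanged. This contradicts rigidity for \<open>K = {i, j}\<close>.
\<close>
lemma no_edge_within_cell:
  assumes P: "P \<in> max_cells S" and ij: "i \<in> {1..n}" "j \<in> {1..n}" "i \<noteq> j"
    and b: "b \<in> label S P i" and s: "s \<in> label S P j"
  shows "(b, s) \<notin> graph n (perm_system n S) i j"
proof
  assume e: "(b, s) \<in> graph n (perm_system n S) i j"
  then have "b \<noteq> s" by (simp add: graph_def)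
  obtain x where x: "x \<in> scaled_simplex (real n)"
    "summand n S x i = axis s 1" "summand n S x j = axis b 1"
    using graph_edge_point[OF e] by blast
  note PC = max_cell_in_cells[OF P]
  define q where "q k = axis (if k = i then b else if k = j then s else SOME c. c \<in> label S P k) (1::real)" for k
  have q: "\<forall>k\<in>{1..n}. q k \<in> face_hull (label S P k)"
    unfolding q_def using b s label_nonempty[OF PC]
    by (auto simp: some_in_eq intro!: axis_in_face_hull)
  define y where "y = (\<Sum>k\<in>{1..n}. q k)"
  have "y \<in> P" using q cell_iff[OF PC] by (auto simp: y_def)
  then have yD: "y \<in> scaled_simplex (real n)" using P Union_max_cells by blast
  have y: "summand n S y k = q k" if "k \<in> {1..n}" for k
    by (rule summand_eq[OF PC q y_def that])
  have "summand n S x i = summand n S y i"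
  proof (rule partial_sum_determines_summands[OF _ x(1) yD])
    show "{i, j} \<subseteq> {1..n}" "i \<in> {i, j}" using ij by auto
    show "(\<Sum>k\<in>{i, j}. summand n S x k) = (\<Sum>k\<in>{i, j}. summand n S y k)"
      using ij x y by (simp add: q_def add.commute)
  qed
  then show False using x(2) y[OF ij(1)] \<open>b \<noteq> s\<close> by (simp add: q_def axis_eq_axis)
qed

text \<open>
  In the cell over \<open>A\<close> the \<open>i\<close>-th label contains \<open>A\<close> and the \<open>j\<close>-th label contains some \<open>s \<in> A\<close>, so no edge
  leads from \<open>A\<close> to \<open>s\<close>. As \<open>A\<close> is an arbitrary nonempty set, the graph is well-founded.
\<close>
lemma acyclic_graph:
  assumes ij: "i \<in> {1..n}" "j \<in> {1..n}" "i \<noteq> j"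
  shows "acyclic (graph n (perm_system n S) i j)"
proof (rule wf_acyclic, unfold wf_eq_minimal, intro allI impI)
  fix A :: "'d set" and a assume "a \<in> A"
  then have "A \<noteq> {}" by blast
  then obtain P where P: "P \<in> max_cells S" "A \<subseteq> label S P i" "label S P j \<inter> A \<noteq> {}"
    using cell_over_face ij by metis
  then obtain s where "s \<in> label S P j" "s \<in> A" by blast
  then show "\<exists>z\<in>A. \<forall>y. (y, z) \<in> graph n (perm_system n S) i j \<longrightarrow> y \<notin> A"
    using no_edge_within_cell[OF P(1) ij] P(2) by blast
qed

text \<open>
  A full \<open>i\<close>-th label uses up the whole dimension of a fine cell, so the other labels are single
  vertices. No edge ends in \<open>a\<close>, and since any two vertices are joined by an edge, all others have an
  incoming edge from \<open>a\<close>.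
\<close>
lemma simplex_label_source:
  assumes P: "P \<in> max_cells S" "label S P i = UNIV"
    and ij: "i \<in> {1..n}" "j \<in> {1..n}" "i \<noteq> j"
  shows "\<exists>a. label S P j = {a} \<and> (\<forall>c. is_source (graph n (perm_system n S) i j) c \<longleftrightarrow> c = a)"
proof -
  let ?L = "label S P"
  have ne: "?L k \<noteq> {}" if "k \<in> {1..n}" for k
    using label_nonempty[OF max_cell_in_cells[OF P(1)] that] .
  have "(\<Sum>k\<in>{1..n}. card (?L k)) = CARD('d) + (card (?L j) + (\<Sum>k\<in>{1..n} - {i} - {j}. card (?L k)))"
    using ij P(2) by (subst sum.remove[of _ i], simp, simp, subst sum.remove[of _ j]) auto
  moreover have "(\<Sum>k\<in>{1..n} - {i} - {j}. 1) \<le> (\<Sum>k\<in>{1..n} - {i} - {j}. card (?L k))"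
    by (rule sum_mono) (use ne in \<open>force simp: Suc_le_eq card_gt_0_iff\<close>)
  moreover have "(\<Sum>k\<in>{1..n} - {i} - {j}. 1) = n - 2" using ij by simp
  moreover have "n \<ge> 2" using ij by (cases "i < j") auto
  ultimately have "card (?L j) \<le> 1"
    using max_cell_label_fine(2)[OF P(1)] by linarith
  moreover have "card (?L j) \<noteq> 0" using ne[OF ij(2)] by simp
  ultimately obtain a where a: "?L j = {a}" by (metis One_nat_def card_1_singletonE le_antisym less_one not_le)
  have src: "(b, a) \<notin> graph n (perm_system n S) i j" for b
    using no_edge_within_cell[OF P(1) ij, of b a] P(2) a by simp
  moreover have "(a, c) \<in> graph n (perm_system n S) i j" if "c \<noteq> a" for c
    using graph_total[OF that ij] src by blast
  ultimately show ?thesis using a by (auto simp: is_source_def)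
qed

text \<open>
  Two cells with full \<open>i\<close>-th label have the same labels, as these are the sources of the graphs, and a
  cell is the Minkowski sum of its labels.
\<close>
lemma ith_simplex_properties:
  assumes i: "i \<in> {1..n}"
  shows "ith_simplex S i \<in> max_cells S" "label S (ith_simplex S i) i = UNIV"
proof -
  obtain P where P: "P \<in> max_cells S" "label S P i = UNIV"
    using cell_over_face[OF UNIV_not_empty i] by (metis top.extremum_uniqueI)
  have "Q = P" if Q: "Q \<in> max_cells S" "label S Q i = UNIV" for Q
  proof -
    have "label S Q k = label S P k" if k: "k \<in> {1..n}" for k
    proof (cases "k = i")
      case False
      then show ?thesis
        using simplex_label_source[OF P i k] simplex_label_source[OF Q i k] by metis
    qed (use P Q in simp)
    then have "minkowski n (label S Q) = minkowski n (label S P)" by (rule minkowski_cong)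
    then show ?thesis
      using cell_eq_minkowski max_cell_in_cells P(1) Q(1)
      by metis
  qed
  with P have "\<exists>!P. P \<in> max_cells S \<and> label S P i = UNIV" by blast
  from theI'[OF this, folded ith_simplex_def]
  show "ith_simplex S i \<in> max_cells S" "label S (ith_simplex S i) i = UNIV" by simp_all
qed

lemma ith_simplex_decomposition:
  assumes ij: "i \<in> {1..n}" "j \<in> {1..n} - {i}"
  shows "\<exists>!a. is_source (graph n (perm_system n S) i j) a"
    and "label S (ith_simplex S i) j = {THE a. is_source (graph n (perm_system n S) i j) a}"
proof -
  obtain a where a: "label S (ith_simplex S i) j = {a}"
    "\<And>c. is_source (graph n (perm_system n S) i j) c \<longleftrightarrow> c = a"
    using simplex_label_source[OF ith_simplex_properties[OF ij(1)] ij(1)] ij(2) by blast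
  then show "\<exists>!a. is_source (graph n (perm_system n S) i j) a"
    and "label S (ith_simplex S i) j = {THE a. is_source (graph n (perm_system n S) i j) a}"
    by simp_all
qed

end

lemma position_determined:
  fixes S S' :: "'d::finite labeled_subdivision"
  assumes n: "n \<ge> 1" and S: "fine_mixed_subdivision n S" and S': "fine_mixed_subdivision n S'"
    and eq: "\<forall>a b. a \<noteq> b \<longrightarrow> (\<forall>r\<in>{1..n}. perm_system n S' a b r = perm_system n S a b r)"
    and i: "i \<in> {1..n}"
  shows "position n S' i = position n S i"
proof
  fix a
  have "appears_before n (perm_system n S' b c) i j \<longleftrightarrow> appears_before n (perm_system n S b c) i j"
    if "b \<noteq> c" for b c j
    unfolding appears_before_def using eq that by simp
  then have "graph n (perm_system n S') i j = graph n (perm_system n S) i j" for j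
    by (auto simp: graph_def)
  then have "label S' (ith_simplex S' i) j = label S (ith_simplex S i) j" if "j \<in> {1..n} - {i}" for j
    using ith_simplex_decomposition(2)[OF n S i that] ith_simplex_decomposition(2)[OF n S' i that] by simp
  then have "{j \<in> {1..n} - {i}. label S' (ith_simplex S' i) j = {a}}
      = {j \<in> {1..n} - {i}. label S (ith_simplex S i) j = {a}}" by blast
  then show "position n S' i a = position n S i a" by (simp only: position_def)
qed

theorem theorem7p1:
  fixes n :: nat and S :: "'d::finite labeled_subdivision"
  assumes "n \<ge> 1" and "fine_mixed_subdivision n S"
  shows "(\<forall>S' :: 'd labeled_subdivision.
            fine_mixed_subdivision n S' \<and>
            (\<forall>a b. a \<noteq> b \<longrightarrow> (\<forall>r\<in>{1..n}. perm_system n S' a b r = perm_system n S a b r)) \<longrightarrow>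
            (\<forall>i\<in>{1..n}. position n S' i = position n S i)) \<and>
         (\<forall>i\<in>{1..n}.
            ith_simplex S i \<in> max_cells S \<and>
            label S (ith_simplex S i) i = UNIV \<and>
            (\<forall>j\<in>{1..n} - {i}.
               acyclic (graph n (perm_system n S) i j) \<and>
               (\<exists>!a. is_source (graph n (perm_system n S) i j) a) \<and>
               label S (ith_simplex S i) j = {THE a. is_source (graph n (perm_system n S) i j) a}))"
proof (intro conjI allI impI ballI)
  fix S' :: "'d labeled_subdivision" and i
  assume S': "fine_mixed_subdivision n S' \<and>
      (\<forall>a b. a \<noteq> b \<longrightarrow> (\<forall>r\<in>{1..n}. perm_system n S' a b r = perm_system n S a b r))"
    and i: "i \<in> {1..n}"
  show "position n S' i = position n S i"
    using position_determined[OF assms _ _ i] S' by blast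
next
  fix i assume i: "i \<in> {1..n}"
  show "ith_simplex S i \<in> max_cells S" "label S (ith_simplex S i) i = UNIV"
    by (rule ith_simplex_properties[OF assms i])+
  fix j assume j: "j \<in> {1..n} - {i}"
  show "acyclic (graph n (perm_system n S) i j)"
    by (rule acyclic_graph[OF assms i]) (use j in auto)
  show "\<exists>!a. is_source (graph n (perm_system n S) i j) a"
    "label S (ith_simplex S i) j = {THE a. is_source (graph n (perm_system n S) i j) a}"
    by (rule ith_simplex_decomposition[OF assms i j])+
qed

end
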